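(* Let $K$ be a field, let $S=K[x_1,\ldots,x_n]$, and let $I\subset S$ be a monomial ideal with linear quotients. If $\operatorname{depth}(S/I)=n-2$, then $\operatorname{sdepth}(S/I)=n-2$.
   Context: For a monomial ideal $I\subset S=K[x_1,\ldots,x_n]$, $G(I)$ denotes its set of minimal monomial generators. $I$ has linear quotients if there is a linear order $u_1\leqslant u_2\leqslant\cdots\leqslant u_m$ on $G(I)$ such that for every $2\le j\le m$ the colon ideal $(u_1,\ldots,u_{j-1}):u_j$ is generated by a subset of the variables $x_1,\ldots,x_n$. Stanley depth: for a $\mathbb Z^n$-graded $S$-module $M$, a Stanley decomposition of $M$ is a direct sum decomposition of $K$-vector spaces $\mathcal D: M=\bigoplus_{i=1}^r m_iK[Z_i]$, where each $m_i\in M$ is homogeneous (with respect to the $\mathbb Z^n$-grading), $Z_i\subset\{x_1,\ldots,x_n\}$, and $m_iK[Z_i]$ is a free $K[Z_i]$-module. Put $\operatorname{sdepth}(\mathcal D)=\min_{1\le i\le r}|Z_i|$ and $\operatorname{sdepth}(M)=\max\{\operatorname{sdepth}(\mathcal D) : \mathcal D \text{ a Stanley decomposition of } M\}$. $\operatorname{depth}$ is the usual depth with respect to the maximal ideal $(x_1,\ldots,x_n)$. *)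

theory Defs
  imports
    "HOL-Algebra.Algebra"
    "HOL-Algebra.Algebraic_Closure_Type"
    "HOL-Library.Poly_Mapping"
    "HOL-Library.Extended_Nat"
    "HOL-Library.Cardinality"
begin

section \<open>The polynomial ring and its monomials\<close>

text \<open>
  The variables of \<open>S = K[x\<^sub>1,\<dots>,x\<^sub>n]\<close> are indexed by a finite type \<open>'n\<close>, so \<open>n = CARD('n)\<close>;
  an exponent vector is an element of \<open>'n \<Rightarrow>\<^sub>0 nat\<close>.
\<close>

type_synonym ('n, 'k) mpoly = "('n \<Rightarrow>\<^sub>0 nat) \<Rightarrow>\<^sub>0 'k"

abbreviation mpoly_ring :: "('n, 'k::field) mpoly ring"
  where "mpoly_ring \<equiv> ring_of_type_algebra"

definition monomial :: "('n \<Rightarrow>\<^sub>0 nat) \<Rightarrow> ('n, 'k::field) mpoly"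
  where "monomial t = Poly_Mapping.single t 1"

definition variable :: "'n \<Rightarrow> ('n, 'k::field) mpoly"
  where "variable i = monomial (Poly_Mapping.single i 1)"

text \<open>The subalgebra \<open>K[Z]\<close>; a set of variables is given by the set \<open>Z\<close> of its indices.\<close>

definition poly_subring :: "'n set \<Rightarrow> ('n, 'k::field) mpoly set"
  where "poly_subring Z = {f. \<forall>t\<in>Poly_Mapping.keys f. Poly_Mapping.keys t \<subseteq> Z}"

definition max_ideal :: "('n, 'k::field) mpoly set"
  where "max_ideal = Idl\<^bsub>mpoly_ring\<^esub> (range variable)"


section \<open>Monomial ideals and linear quotients\<close>

definition monomial_ideal :: "('n, 'k::field) mpoly set \<Rightarrow> bool"
  where "monomial_ideal I \<longleftrightarrow> (\<exists>A \<subseteq> range monomial. I = Idl\<^bsub>mpoly_ring\<^esub> A)"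

text \<open>The monomials in \<open>I\<close> that are minimal with respect to divisibility.\<close>

definition min_gens :: "('n, 'k::field) mpoly set \<Rightarrow> ('n, 'k) mpoly set"
  where "min_gens I =
    {u \<in> I \<inter> range monomial. \<forall>v \<in> I \<inter> range monomial. v divides\<^bsub>mpoly_ring\<^esub> u \<longrightarrow> v = u}"

definition colon_ideal :: "('a, 'm) ring_scheme \<Rightarrow> 'a set \<Rightarrow> 'a \<Rightarrow> 'a set"
  where "colon_ideal R J u = {f \<in> carrier R. f \<otimes>\<^bsub>R\<^esub> u \<in> J}"

text \<open>Lists are indexed from 0, hence the range \<open>1 \<le> j < m\<close>.\<close>

definition has_linear_quotients :: "('n, 'k::field) mpoly set \<Rightarrow> bool"
  where "has_linear_quotients I \<longleftrightarrow>
    (\<exists>us. distinct us \<and> set us = min_gens I \<and>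
      (\<forall>j. 1 \<le> j \<and> j < length us \<longrightarrow>
        (\<exists>Z. colon_ideal mpoly_ring (Idl\<^bsub>mpoly_ring\<^esub> (set (take j us))) (us ! j)
             = Idl\<^bsub>mpoly_ring\<^esub> (variable ` Z))))"


section \<open>Depth\<close>

text \<open>
  The quotient of \<open>R\<close> by \<open>I\<close> as an \<open>R\<close>-module. Its elements are the cosets of \<open>I\<close>; the fields
  \<open>mult\<close> and \<open>one\<close> of a module record play no role.
\<close>

definition quotient_module :: "('a, 'm) ring_scheme \<Rightarrow> 'a set \<Rightarrow> ('a, 'a set) module"
  where "quotient_module R I =
    \<lparr>carrier = carrier (R Quot I), monoid.mult = monoid.mult (R Quot I),
     monoid.one = monoid.one (R Quot I),
     ring.zero = ring.zero (R Quot I), ring.add = ring.add (R Quot I),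
     module.smult = (\<lambda>f C. (I +>\<^bsub>R\<^esub> f) \<otimes>\<^bsub>R Quot I\<^esub> C)\<rparr>"

text \<open>The submodule \<open>J M\<close> of \<open>M\<close>, for an ideal \<open>J\<close>.\<close>

definition ideal_smult :: "'a set \<Rightarrow> ('a, 'b, 'c) module_scheme \<Rightarrow> 'b set"
  where "ideal_smult J M =
    {\<Oplus>\<^bsub>M\<^esub>i\<in>{..<k}. a i \<odot>\<^bsub>M\<^esub> x i | (k::nat) a x.
       a \<in> {..<k} \<rightarrow> J \<and> x \<in> {..<k} \<rightarrow> carrier M}"

text \<open>
  \<open>f\<^sub>1,\<dots>,f\<^sub>r\<close> is \<open>M\<close>-regular if \<open>f\<^sub>i\<close> is a nonzerodivisor on \<open>M/(f\<^sub>1,\<dots>,f\<^bsub>i-1\<^esub>)M\<close> for all \<open>i\<close>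
  and \<open>M/(f\<^sub>1,\<dots>,f\<^sub>r)M \<noteq> 0\<close>.
\<close>

definition regular_sequence ::
    "('a, 'm) ring_scheme \<Rightarrow> ('a, 'b, 'c) module_scheme \<Rightarrow> 'a list \<Rightarrow> bool"
  where "regular_sequence R M fs \<longleftrightarrow>
    set fs \<subseteq> carrier R \<and>
    (\<forall>i < length fs. \<forall>x \<in> carrier M.
       fs ! i \<odot>\<^bsub>M\<^esub> x \<in> ideal_smult (Idl\<^bsub>R\<^esub> (set (take i fs))) M \<longrightarrow>
       x \<in> ideal_smult (Idl\<^bsub>R\<^esub> (set (take i fs))) M) \<and>
    ideal_smult (Idl\<^bsub>R\<^esub> (set fs)) M \<noteq> carrier M"

text \<open>
  The depth of \<open>M\<close> with respect to \<open>J\<close>, with the usual convention that it is \<open>\<infinity>\<close> if \<open>J M = M\<close>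
  (in particular for \<open>M = 0\<close>).
\<close>

definition depth :: "('a, 'm) ring_scheme \<Rightarrow> 'a set \<Rightarrow> ('a, 'b, 'c) module_scheme \<Rightarrow> enat"
  where "depth R J M =
    (if ideal_smult J M = carrier M then \<infinity>
     else (SUP fs \<in> {fs. set fs \<subseteq> J \<and> regular_sequence R M fs}. enat (length fs)))"


section \<open>Stanley depth\<close>

text \<open>
  A \<open>\<int>\<^sup>n\<close>-grading of an \<open>S\<close>-module is given by the function \<open>gr\<close> that maps a degree \<open>a\<close> to the
  homogeneous component of degree \<open>a\<close>. The component of \<open>S/I\<close> of degree \<open>a\<close> is the image of
  \<open>K x\<^sup>a\<close> (zero if some entry of \<open>a\<close> is negative).
\<close>

definition quotient_grading :: "('n, 'k::field) mpoly set \<Rightarrow> ('n \<Rightarrow> int) \<Rightarrow> ('n, 'k) mpoly set set"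
  where "quotient_grading I a =
    (\<lambda>f. I +>\<^bsub>mpoly_ring\<^esub> f) `
      {f. \<forall>t\<in>Poly_Mapping.keys f. \<forall>i. int (Poly_Mapping.lookup t i) = a i}"

text \<open>The set \<open>m K[Z]\<close>.\<close>

definition stanley_space ::
    "(('n, 'k::field) mpoly, 'b, 'c) module_scheme \<Rightarrow> 'b \<Rightarrow> 'n set \<Rightarrow> 'b set"
  where "stanley_space M m Z = (\<lambda>f. f \<odot>\<^bsub>M\<^esub> m) ` poly_subring Z"

text \<open>
  The decomposition \<open>M = \<Oplus>\<^sub>i m\<^sub>i K[Z\<^sub>i]\<close> is encoded as the list of the pairs \<open>(m\<^sub>i, Z\<^sub>i)\<close>. The
  second condition says that \<open>m\<^sub>i K[Z\<^sub>i]\<close> is free over \<open>K[Z\<^sub>i]\<close> with basis \<open>m\<^sub>i\<close>.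
\<close>

definition stanley_decomposition ::
    "(('n, 'k::field) mpoly, 'b, 'c) module_scheme \<Rightarrow> (('n \<Rightarrow> int) \<Rightarrow> 'b set) \<Rightarrow>
     ('b \<times> 'n set) list \<Rightarrow> bool"
  where "stanley_decomposition M gr D \<longleftrightarrow>
    (\<forall>(m, Z) \<in> set D. m \<in> carrier M \<and> (\<exists>a. m \<in> gr a)) \<and>
    (\<forall>(m, Z) \<in> set D. \<forall>f \<in> poly_subring Z. f \<odot>\<^bsub>M\<^esub> m = \<zero>\<^bsub>M\<^esub> \<longrightarrow> f = 0) \<and>
    (\<forall>x \<in> carrier M.
       \<exists>!y. y \<in> (\<Pi>\<^sub>E i\<in>{..<length D}. stanley_space M (fst (D ! i)) (snd (D ! i))) \<and>
            x = (\<Oplus>\<^bsub>M\<^esub>i\<in>{..<length D}. y i))"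

definition sdepth_decomposition :: "('b \<times> 'n set) list \<Rightarrow> enat"
  where "sdepth_decomposition D = (INF (m, Z) \<in> set D. enat (card Z))"

definition sdepth ::
    "(('n, 'k::field) mpoly, 'b, 'c) module_scheme \<Rightarrow> (('n \<Rightarrow> int) \<Rightarrow> 'b set) \<Rightarrow> enat"
  where "sdepth M gr = (SUP D \<in> {D. stanley_decomposition M gr D}. sdepth_decomposition D)"

end

theory Submission
  imports Defs
begin

text \<open>
  Order the generators by degree first; this keeps linear quotients. Let \<open>v\<close> be a generator such that
  \<open>x\<^sub>a\<close> and \<open>x\<^sub>c\<close> (\<open>a \<noteq> c\<close>) both multiply \<open>v\<close> into the ideal of the earlier generators. In the
  multidegree \<open>v x\<^sub>a x\<^sub>c\<close> of the Koszul complex of \<open>S/I\<close> this yields a cycle of homological degree 3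
  which is not a boundary, so that \<open>depth (S/I) \<le> n - 3\<close>. Hence if the depth is \<open>n - 2\<close>, then every
  colon ideal is generated by at most one variable. Adding the generators one at a time then cuts
  the monomials outside \<open>I\<close> into cones of dimension at least \<open>n - 2\<close>: if the new generator \<open>v\<close> has
  colon ideal \<open>(x\<^sub>a)\<close>, then all earlier generators have a larger exponent at \<open>x\<^sub>a\<close> than \<open>v\<close>, so the part
  of \<open>x\<^sub>a\<close>-degree above that of \<open>v\<close> does not change, and below it only multiples of \<open>v\<close> are removed.

  Conversely, \<open>I\<close> is not principal, since otherwise the forms \<open>x\<^sub>j - x\<^sub>i\<close> (\<open>i\<close> fixed, \<open>j \<noteq> i\<close>) would be a
  regular sequence of length \<open>n - 1\<close>. So the greatest common divisor of \<open>I\<close> lies outside \<open>I\<close>, and the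
  piece of a Stanley decomposition that contains it has dimension at most \<open>n - 2\<close>.
\<close>


section \<open>Ideals and quotient modules of a commutative ring given by a type class\<close>

text \<open>The degree order is what makes the non-bounding cycle exist. With it every earlier
  generator has degree at most \<open>deg v\<close>, hence stays at least two degrees below
  \<open>b = v x_a x_c\<close>. An earlier generator and its linear quotient witness, which exceeds
  it by at most one factor, are then both below \<open>b\<close> at a common variable, and this
  keeps the supports connected. The cycle is not given by a formula: a path from \<open>a\<close> to
  \<open>c\<close> is followed edge by edge, and the part already travelled is filled with triangles
  that have \<open>a\<close> as a vertex. Depth enters through regular sequences only. One of length
  \<open>n - 2\<close> turns Koszul cycles of degree at least 3 over \<open>S/I\<close> into
  boundaries; chains are taken over \<open>S\<close>, and equality becomes congruence modulo an
  ideal. In the cone construction the two lost dimensions have different causes: one for fixing the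
  exponent of \<open>x_a\<close> in each layer, one for removing the multiples of \<open>v\<close>
  from that layer.\<close>

lemma ring_of_type_algebra_simps [simp]:
  fixes x y :: "'a::comm_ring_1"
  shows "carrier (ring_of_type_algebra :: 'a ring) = UNIV"
    and "x \<otimes>\<^bsub>ring_of_type_algebra\<^esub> y = x * y"
    and "x \<oplus>\<^bsub>ring_of_type_algebra\<^esub> y = x + y"
    and "\<one>\<^bsub>ring_of_type_algebra\<^esub> = (1::'a)"
    and "\<zero>\<^bsub>ring_of_type_algebra\<^esub> = (0::'a)"
  by (simp_all add: ring_of_type_algebra_def)

abbreviation is_ideal :: "'a::comm_ring_1 set \<Rightarrow> bool"
  where "is_ideal I \<equiv> ideal I ring_of_type_algebra"

abbreviation ideal_of :: "'a::comm_ring_1 set \<Rightarrow> 'a set"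
  where "ideal_of A \<equiv> Idl\<^bsub>ring_of_type_algebra\<^esub> A"

lemma is_idealI:
  fixes I :: "'a::comm_ring_1 set"
  assumes "0 \<in> I" and "\<And>x y. x \<in> I \<Longrightarrow> y \<in> I \<Longrightarrow> x + y \<in> I"
    and "\<And>r x. x \<in> I \<Longrightarrow> r * x \<in> I"
  shows "is_ideal I"
proof (rule idealI)
  interpret ring "ring_of_type_algebra :: 'a ring" by (rule ring_from_type_algebra)
  show "ring (ring_of_type_algebra :: 'a ring)" by (rule ring_from_type_algebra)
  show "subgroup I (add_monoid (ring_of_type_algebra :: 'a ring))"
  proof (rule add.subgroupI)
    show "I \<subseteq> carrier ring_of_type_algebra" by simp
    show "I \<noteq> {}" using assms(1) by blast
    show "\<ominus>\<^bsub>ring_of_type_algebra\<^esub> a \<in> I" if "a \<in> I" for a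
    proof -
      have "a + (- 1) * a = 0" by simp
      hence "\<ominus>\<^bsub>ring_of_type_algebra\<^esub> a = (- 1) * a"
        using minus_equality[of "(-1) * a" a] by (simp add: add.commute)
      thus ?thesis using assms(3)[OF that, of "-1"] by simp
    qed
    show "a \<oplus>\<^bsub>ring_of_type_algebra\<^esub> b \<in> I" if "a \<in> I" "b \<in> I" for a b
      using assms(2) that by simp
  qed
  show "x \<otimes>\<^bsub>ring_of_type_algebra\<^esub> a \<in> I" if "a \<in> I" for a x
    using assms(3) that by simp
  show "a \<otimes>\<^bsub>ring_of_type_algebra\<^esub> x \<in> I" if "a \<in> I" for a x
    using assms(3)[OF that, of x] by (simp add: mult.commute)
qed

context
  fixes I :: "'a::comm_ring_1 set"
  assumes I: "is_ideal I"
begin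

interpretation ideal I "ring_of_type_algebra :: 'a ring" by (rule I)

lemma is_ideal_0: "0 \<in> I"
  using additive_subgroup.zero_closed[OF ideal.axioms(1)[OF I]] by simp

lemma is_ideal_add: "x \<in> I \<Longrightarrow> y \<in> I \<Longrightarrow> x + y \<in> I"
  using additive_subgroup.a_closed[OF ideal.axioms(1)[OF I], of x y] by simp

lemma is_ideal_mult: "x \<in> I \<Longrightarrow> r * x \<in> I"
  using I_l_closed[of x r] by simp

lemma is_ideal_uminus: "x \<in> I \<Longrightarrow> - x \<in> I"
  using is_ideal_mult[of x "- 1"] by simp

lemma is_ideal_diff: "x \<in> I \<Longrightarrow> y \<in> I \<Longrightarrow> x - y \<in> I"
  using is_ideal_add[of x "- y"] is_ideal_uminus[of y] by simp

lemma is_ideal_sum: "(\<And>i. i \<in> A \<Longrightarrow> f i \<in> I) \<Longrightarrow> sum f A \<in> I"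
  by (induction A rule: infinite_finite_induct) (auto intro: is_ideal_0 is_ideal_add)

lemma is_ideal_eq_UNIV: "1 \<in> I \<Longrightarrow> I = UNIV"
  using is_ideal_mult[of 1] by auto

end

context
  fixes I :: "'a::comm_ring_1 set"
  assumes I: "is_ideal I"
begin

interpretation ideal I "ring_of_type_algebra :: 'a ring" by (rule I)

lemma coset_eq: "I +>\<^bsub>ring_of_type_algebra\<^esub> f = (\<lambda>h. h + f) ` I"
  by (auto simp: a_r_coset_def')

lemma coset_eq_iff:
  "I +>\<^bsub>ring_of_type_algebra\<^esub> f = I +>\<^bsub>ring_of_type_algebra\<^esub> g \<longleftrightarrow> f - g \<in> I"
proof
  assume "I +>\<^bsub>ring_of_type_algebra\<^esub> f = I +>\<^bsub>ring_of_type_algebra\<^esub> g"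
  moreover have "f \<in> I +>\<^bsub>ring_of_type_algebra\<^esub> f" using is_ideal_0[OF I] by (auto simp: coset_eq)
  ultimately show "f - g \<in> I" by (auto simp: coset_eq)
next
  assume fg: "f - g \<in> I"
  have "\<exists>h'\<in>I. h + f = h' + g" if "h \<in> I" for h
    using is_ideal_add[OF I that fg] by (intro bexI[of _ "h + (f - g)"]) auto
  moreover have "\<exists>h'\<in>I. h + g = h' + f" if "h \<in> I" for h
    using is_ideal_diff[OF I that fg] by (intro bexI[of _ "h - (f - g)"]) auto
  ultimately show "I +>\<^bsub>ring_of_type_algebra\<^esub> f = I +>\<^bsub>ring_of_type_algebra\<^esub> g"
    by (auto simp: coset_eq image_iff)
qed

lemma carrier_quotient_module:
  "carrier (quotient_module ring_of_type_algebra I) = range (\<lambda>f. I +>\<^bsub>ring_of_type_algebra\<^esub> f)"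
  by (auto simp: quotient_module_def FactRing_def A_RCOSETS_def')

lemma zero_quotient_module:
  "\<zero>\<^bsub>quotient_module ring_of_type_algebra I\<^esub> = I +>\<^bsub>ring_of_type_algebra\<^esub> 0"
  by (auto simp: quotient_module_def FactRing_def coset_eq)

lemma smult_quotient_module:
  "f \<odot>\<^bsub>quotient_module ring_of_type_algebra I\<^esub> (I +>\<^bsub>ring_of_type_algebra\<^esub> g)
   = I +>\<^bsub>ring_of_type_algebra\<^esub> (f * g)"
  using rcoset_mult_add[of f g] by (simp add: quotient_module_def FactRing_def)

lemma abelian_monoid_quotient_module:
  "abelian_monoid (quotient_module ring_of_type_algebra I)"
proof -
  interpret Q: ring "ring_of_type_algebra Quot I" by (rule quotient_is_ring)
  show ?thesis
    by (rule abelian_monoidI) (simp_all add: quotient_module_def Q.a_assoc Q.a_comm Q.a_lcomm)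
qed

lemma add_quotient_module:
  "(I +>\<^bsub>ring_of_type_algebra\<^esub> f) \<oplus>\<^bsub>quotient_module ring_of_type_algebra I\<^esub> (I +>\<^bsub>ring_of_type_algebra\<^esub> g)
   = I +>\<^bsub>ring_of_type_algebra\<^esub> (f + g)"
  using ring_hom_add[OF rcos_ring_hom, of f g] by (simp add: quotient_module_def)

lemma finsum_quotient_module:
  assumes "finite A" and y: "\<And>i. i \<in> A \<Longrightarrow> y i = I +>\<^bsub>ring_of_type_algebra\<^esub> f i"
  shows "(\<Oplus>\<^bsub>quotient_module ring_of_type_algebra I\<^esub>i\<in>A. y i)
    = I +>\<^bsub>ring_of_type_algebra\<^esub> (\<Sum>i\<in>A. f i)"
  using assms
proof (induction rule: finite_induct)
  case empty
  show ?case
    by (simp add: abelian_monoid.finsum_empty[OF abelian_monoid_quotient_module] zero_quotient_module)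
next
  case (insert x F)
  have "y \<in> insert x F \<rightarrow> carrier (quotient_module ring_of_type_algebra I)"
    using insert.prems by (auto simp: carrier_quotient_module)
  thus ?case using insert
    by (subst abelian_monoid.finsum_insert[OF abelian_monoid_quotient_module])
      (auto simp: add_quotient_module)
qed

lemma ideal_smult_quotient_module:
  assumes J: "is_ideal J"
  shows "ideal_smult J (quotient_module ring_of_type_algebra I)
    = (\<lambda>f. I +>\<^bsub>ring_of_type_algebra\<^esub> f) ` J"
proof (intro equalityI subsetI)
  fix C assume "C \<in> ideal_smult J (quotient_module ring_of_type_algebra I)"
  then obtain k :: nat and a x where
    C: "C = (\<Oplus>\<^bsub>quotient_module ring_of_type_algebra I\<^esub>i\<in>{..<k}.
          a i \<odot>\<^bsub>quotient_module ring_of_type_algebra I\<^esub> x i)"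
    and a: "a \<in> {..<k} \<rightarrow> J"
    and x: "x \<in> {..<k} \<rightarrow> carrier (quotient_module ring_of_type_algebra I)"
    unfolding ideal_smult_def by blast
  have "\<forall>i\<in>{..<k}. \<exists>g. x i = I +>\<^bsub>ring_of_type_algebra\<^esub> g"
    using x by (auto simp: carrier_quotient_module)
  then obtain g where g: "\<And>i. i \<in> {..<k} \<Longrightarrow> x i = I +>\<^bsub>ring_of_type_algebra\<^esub> g i"
    by metis
  have "C = I +>\<^bsub>ring_of_type_algebra\<^esub> (\<Sum>i<k. a i * g i)"
    unfolding C by (rule finsum_quotient_module) (auto simp: g smult_quotient_module)
  moreover have "(\<Sum>i<k. a i * g i) \<in> J"
    using a by (intro is_ideal_sum[OF J]) (auto simp: mult.commute[of "a _"] intro!: is_ideal_mult[OF J])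
  ultimately show "C \<in> (\<lambda>f. I +>\<^bsub>ring_of_type_algebra\<^esub> f) ` J" by blast
next
  fix C assume "C \<in> (\<lambda>f. I +>\<^bsub>ring_of_type_algebra\<^esub> f) ` J"
  then obtain g where g: "g \<in> J" "C = I +>\<^bsub>ring_of_type_algebra\<^esub> g" by blast
  let ?x = "\<lambda>_::nat. I +>\<^bsub>ring_of_type_algebra\<^esub> (1::'a)"
  have "C = (\<Oplus>\<^bsub>quotient_module ring_of_type_algebra I\<^esub>i\<in>{..<1::nat}.
          (\<lambda>_. g) i \<odot>\<^bsub>quotient_module ring_of_type_algebra I\<^esub> ?x i)"
    using g finsum_quotient_module[of "{..<1::nat}" _ "\<lambda>_. g"] by (simp add: smult_quotient_module)
  thus "C \<in> ideal_smult J (quotient_module ring_of_type_algebra I)"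
    unfolding ideal_smult_def mem_Collect_eq
    by (intro exI[of _ "1::nat"] exI[of _ "\<lambda>_. g"] exI[of _ ?x])
      (use g in \<open>auto simp: carrier_quotient_module\<close>)
qed

end

lemma ideal_of_is_ideal: "is_ideal (ideal_of (A :: 'a::comm_ring_1 set))"
  by (rule ring.genideal_ideal[OF ring_from_type_algebra]) simp

lemma subset_ideal_of: "(A :: 'a::comm_ring_1 set) \<subseteq> ideal_of A"
  by (rule ring.genideal_self[OF ring_from_type_algebra]) simp

lemma ideal_of_minimal: "is_ideal J \<Longrightarrow> (A :: 'a::comm_ring_1 set) \<subseteq> J \<Longrightarrow> ideal_of A \<subseteq> J"
  by (rule ring.genideal_minimal[OF ring_from_type_algebra])

lemma ideal_of_mono: "(A :: 'a::comm_ring_1 set) \<subseteq> B \<Longrightarrow> ideal_of A \<subseteq> ideal_of B"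
  by (meson ideal_of_minimal ideal_of_is_ideal subset_ideal_of order_trans)

text \<open>The preimage in the ring of the submodule \<open>J (R/I)\<close>. It allows regularity
  on a quotient module to be stated for ring elements.\<close>

definition ideal_sum :: "'a::comm_ring_1 set \<Rightarrow> 'a set \<Rightarrow> 'a set"
  where "ideal_sum J I = {g + h | g h. g \<in> J \<and> h \<in> I}"

lemma is_ideal_ideal_sum:
  assumes J: "is_ideal J" and I: "is_ideal I"
  shows "is_ideal (ideal_sum J I)"
proof (rule is_idealI)
  show "0 \<in> ideal_sum J I"
    using is_ideal_0[OF J] is_ideal_0[OF I] unfolding ideal_sum_def by force
  show "x + y \<in> ideal_sum J I" if xy: "x \<in> ideal_sum J I" "y \<in> ideal_sum J I" for x y
  proof -
    obtain g h g' h' where "x = g + h" "y = g' + h'" "g \<in> J" "g' \<in> J" "h \<in> I" "h' \<in> I"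
      using xy unfolding ideal_sum_def by blast
    moreover from this have "x + y = (g + g') + (h + h')" by simp
    ultimately show ?thesis
      using is_ideal_add[OF J] is_ideal_add[OF I] unfolding ideal_sum_def by blast
  qed
  show "r * x \<in> ideal_sum J I" if "x \<in> ideal_sum J I" for r x
  proof -
    obtain g h where "x = g + h" "g \<in> J" "h \<in> I"
      using \<open>x \<in> ideal_sum J I\<close> unfolding ideal_sum_def by blast
    moreover from this have "r * x = r * g + r * h" by (simp add: distrib_left)
    ultimately show ?thesis using is_ideal_mult[OF J] is_ideal_mult[OF I] unfolding ideal_sum_def
      by blast
  qed
qed

lemma subset_ideal_sum:
  assumes "is_ideal J" "is_ideal I"
  shows "J \<subseteq> ideal_sum J I" "I \<subseteq> ideal_sum J I"
proof -
  have "x + 0 \<in> ideal_sum J I" if "x \<in> J" for x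
    using that is_ideal_0[OF assms(2)] unfolding ideal_sum_def by blast
  moreover have "0 + x \<in> ideal_sum J I" if "x \<in> I" for x
    using that is_ideal_0[OF assms(1)] unfolding ideal_sum_def by blast
  ultimately show "J \<subseteq> ideal_sum J I" "I \<subseteq> ideal_sum J I" by auto
qed

lemma ideal_sum_mono: "J \<subseteq> J' \<Longrightarrow> ideal_sum J I \<subseteq> ideal_sum J' I"
  unfolding ideal_sum_def by blast

lemma ideal_sum_minimal: "is_ideal K \<Longrightarrow> J \<subseteq> K \<Longrightarrow> I \<subseteq> K \<Longrightarrow> ideal_sum J I \<subseteq> K"
  unfolding ideal_sum_def using is_ideal_add by blast

lemma ideal_sum_zero: "ideal_sum {0} I = I"
  by (simp add: ideal_sum_def)

lemma ideal_of_empty: "ideal_of {} = {0 :: 'a::comm_ring_1}"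
proof -
  have "is_ideal {0 :: 'a}" by (rule is_idealI) auto
  from ideal_of_minimal[OF this, of "{}"] show ?thesis
    using is_ideal_0[OF ideal_of_is_ideal] by blast
qed

lemma ideal_of_insert:
  assumes "a \<in> ideal_of (insert f A)"
  obtains b c :: "'a::comm_ring_1" where "b \<in> ideal_of A" "a = b + c * f"
proof -
  let ?K = "ideal_sum (ideal_of A) (range (\<lambda>c. c * f))"
  have "is_ideal (range (\<lambda>c. c * f))"
  proof (rule is_idealI)
    show "0 \<in> range (\<lambda>c. c * f)" by (rule range_eqI[of _ _ 0]) simp
    show "x + y \<in> range (\<lambda>c. c * f)" if "x \<in> range (\<lambda>c. c * f)" "y \<in> range (\<lambda>c. c * f)" for x y
      using that by (auto simp: distrib_right[symmetric])
    show "r * x \<in> range (\<lambda>c. c * f)" if "x \<in> range (\<lambda>c. c * f)" for r x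
      using that by (auto simp: mult.assoc[symmetric])
  qed
  note K = this
  have "f \<in> range (\<lambda>c. c * f)" by (rule range_eqI[of _ _ 1]) simp
  hence "insert f A \<subseteq> ?K"
    using subset_ideal_sum[OF ideal_of_is_ideal K, of A] subset_ideal_of[of A] by auto
  hence "ideal_of (insert f A) \<subseteq> ?K"
    by (rule ideal_of_minimal[OF is_ideal_ideal_sum[OF ideal_of_is_ideal K]])
  thus thesis using assms that unfolding ideal_sum_def by blast
qed

lemma coset_mem_image_iff:
  assumes "is_ideal I"
  shows "I +>\<^bsub>ring_of_type_algebra\<^esub> f \<in> (\<lambda>f. I +>\<^bsub>ring_of_type_algebra\<^esub> f) ` J
    \<longleftrightarrow> f \<in> ideal_sum J I"
proof -
  have "(\<exists>g\<in>J. f - g \<in> I) \<longleftrightarrow> f \<in> ideal_sum J I"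
  proof
    assume "\<exists>g\<in>J. f - g \<in> I"
    then obtain g where "g \<in> J" "f - g \<in> I" "f = g + (f - g)" by auto
    thus "f \<in> ideal_sum J I" unfolding ideal_sum_def by blast
  next
    assume "f \<in> ideal_sum J I"
    then obtain g h where "g \<in> J" "h \<in> I" "f - g = h" unfolding ideal_sum_def by auto
    thus "\<exists>g\<in>J. f - g \<in> I" by blast
  qed
  thus ?thesis by (auto simp: image_iff coset_eq_iff[OF assms])
qed

lemma ideal_smult_eq_carrier_iff:
  assumes I: "is_ideal I" and J: "is_ideal J"
  shows "ideal_smult J (quotient_module ring_of_type_algebra I)
      = carrier (quotient_module ring_of_type_algebra I) \<longleftrightarrow> ideal_sum J I = UNIV"
proof -
  have "h ` J = range h \<longleftrightarrow> (\<forall>f. h f \<in> h ` J)" for h :: "'a \<Rightarrow> 'a set"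
    by blast
  thus ?thesis
    unfolding ideal_smult_quotient_module[OF I J] carrier_quotient_module[OF I]
    by (simp only: coset_mem_image_iff[OF I, of _ J]) blast
qed

text \<open>From here on cosets disappear from questions of regularity: being a nonzerodivisor on
  \<open>M/(f_1,...,f_i)M\<close> becomes a cancellation rule modulo the ideal
  \<open>(f_1,...,f_i) + I\<close>.\<close>

lemma regular_sequence_quotient_module:
  fixes I :: "'a::comm_ring_1 set"
  assumes I: "is_ideal I"
  shows "regular_sequence ring_of_type_algebra (quotient_module ring_of_type_algebra I) fs \<longleftrightarrow>
    (\<forall>i<length fs. \<forall>x. fs ! i * x \<in> ideal_sum (ideal_of (set (take i fs))) I \<longrightarrow>
       x \<in> ideal_sum (ideal_of (set (take i fs))) I) \<and>
    ideal_sum (ideal_of (set fs)) I \<noteq> UNIV"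
proof -
  have "(\<forall>x\<in>range h. P x) \<longleftrightarrow> (\<forall>f. P (h f))" for h :: "'a \<Rightarrow> 'a set" and P
    by blast
  thus ?thesis
    using ideal_smult_eq_carrier_iff[OF I ideal_of_is_ideal, of "set fs"]
    unfolding regular_sequence_def
      carrier_quotient_module[OF I] ideal_smult_quotient_module[OF I ideal_of_is_ideal]
    by (simp only: smult_quotient_module[OF I] coset_mem_image_iff[OF I]) simp
qed

text \<open>A bounded nonempty set of lengths attains its supremum, so a finite depth yields a
  regular sequence of that very length besides bounding all others. The empty sequence shows that
  the set is nonempty.\<close>

lemma depth_quotient_module:
  fixes I :: "'a::comm_ring_1 set"
  assumes I: "is_ideal I" and J: "is_ideal J"
    and depth: "depth ring_of_type_algebra J (quotient_module ring_of_type_algebra I) = enat d"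
  shows "ideal_sum J I \<noteq> UNIV"
    and "\<exists>fs. set fs \<subseteq> J \<and> length fs = d \<and>
      regular_sequence ring_of_type_algebra (quotient_module ring_of_type_algebra I) fs"
    and "\<And>fs. set fs \<subseteq> J \<Longrightarrow>
      regular_sequence ring_of_type_algebra (quotient_module ring_of_type_algebra I) fs \<Longrightarrow>
        length fs \<le> d"
proof -
  let ?A = "{fs. set fs \<subseteq> J \<and> regular_sequence ring_of_type_algebra (quotient_module ring_of_type_algebra I) fs}"
  show ne: "ideal_sum J I \<noteq> UNIV"
    using depth by (auto simp: depth_def ideal_smult_eq_carrier_iff[OF I J])
  hence sup: "(SUP fs\<in>?A. enat (length fs)) = enat d"
    using depth by (simp add: depth_def ideal_smult_eq_carrier_iff[OF I J])
  show le: "length fs \<le> d" if "set fs \<subseteq> J"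
    "regular_sequence ring_of_type_algebra (quotient_module ring_of_type_algebra I) fs" for fs
  proof -
    have "enat (length fs) \<le> (SUP fs\<in>?A. enat (length fs))" using that by (intro SUP_upper) auto
    thus ?thesis by (simp add: sup)
  qed
  have "I \<noteq> UNIV" using ne subset_ideal_sum(2)[OF J I] by blast
  hence "[] \<in> ?A"
    by (simp add: regular_sequence_quotient_module[OF I] ideal_of_empty ideal_sum_zero)
  have Sup_in: "Sup B \<in> B" if "finite B" "B \<noteq> {}" for B :: "enat set"
    using that Max_in[of B] by (simp add: Sup_enat_def)
  have "(\<lambda>fs. enat (length fs)) ` ?A \<noteq> {}" using \<open>[] \<in> ?A\<close> by blast
  moreover have "(\<lambda>fs. enat (length fs)) ` ?A \<subseteq> enat ` {..d}"
    using le by auto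
  hence "finite ((\<lambda>fs. enat (length fs)) ` ?A)" by (rule finite_subset) simp
  ultimately have "(SUP fs\<in>?A. enat (length fs)) \<in> (\<lambda>fs. enat (length fs)) ` ?A"
    using Sup_in by blast
  thus "\<exists>fs. set fs \<subseteq> J \<and> length fs = d \<and>
      regular_sequence ring_of_type_algebra (quotient_module ring_of_type_algebra I) fs"
    unfolding sup by auto
qed


section \<open>Exponent vectors and linear quotients\<close>

abbreviation lookup :: "('a \<Rightarrow>\<^sub>0 'b::zero) \<Rightarrow> 'a \<Rightarrow> 'b"
  where "lookup \<equiv> Poly_Mapping.lookup"

abbreviation keys :: "('a \<Rightarrow>\<^sub>0 'b::zero) \<Rightarrow> 'a set"
  where "keys \<equiv> Poly_Mapping.keys"

definition exp_le :: "('a \<Rightarrow>\<^sub>0 nat) \<Rightarrow> ('a \<Rightarrow>\<^sub>0 nat) \<Rightarrow> bool"  (infix \<open>\<preceq>\<close> 50)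
  where "s \<preceq> t \<longleftrightarrow> (\<forall>i. lookup s i \<le> lookup t i)"

definition unit_exp :: "'a \<Rightarrow> 'a \<Rightarrow>\<^sub>0 nat"
  where "unit_exp a = Poly_Mapping.single a 1"

lemma exp_le_refl [simp]: "t \<preceq> t"
  by (simp add: exp_le_def)

lemma exp_le_trans: "s \<preceq> t \<Longrightarrow> t \<preceq> u \<Longrightarrow> s \<preceq> u"
  by (meson exp_le_def order_trans)

lemma exp_le_add [simp]: "s \<preceq> s + r" "s \<preceq> r + s"
  by (simp_all add: exp_le_def lookup_add)

lemma exp_le_diff: "s \<preceq> t \<Longrightarrow> s + (t - s) = t"
  by (rule poly_mapping_eqI) (simp add: exp_le_def lookup_add lookup_minus)

lemma exp_le_iff_add: "s \<preceq> t \<longleftrightarrow> (\<exists>r. t = s + r)"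
  by (metis exp_le_add(1) exp_le_diff)

lemma lookup_unit_exp: "lookup (unit_exp a) i = (if i = a then 1 else 0)"
  by (simp add: unit_exp_def lookup_single when_def)

definition total_deg :: "('n::finite \<Rightarrow>\<^sub>0 nat) \<Rightarrow> nat"
  where "total_deg t = (\<Sum>i\<in>UNIV. lookup t i)"

lemma total_deg_add [simp]: "total_deg (s + t) = total_deg s + total_deg t"
  by (simp add: total_deg_def lookup_add sum.distrib)

lemma total_deg_unit_exp [simp]: "total_deg (unit_exp a) = 1"
  by (simp add: total_deg_def lookup_unit_exp)

lemma total_deg_eq_0_iff: "total_deg t = 0 \<longleftrightarrow> t = 0"
  by (auto simp: total_deg_def intro!: poly_mapping_eqI)

lemma total_deg_mono: "s \<preceq> t \<Longrightarrow> total_deg s \<le> total_deg t"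
  by (auto simp: exp_le_iff_add)

lemma total_deg_strict_mono: "s \<preceq> t \<Longrightarrow> s \<noteq> t \<Longrightarrow> total_deg s < total_deg t"
  by (auto simp: exp_le_iff_add total_deg_eq_0_iff neq0_conv[symmetric] simp del: neq0_conv)

definition up_closed :: "('a \<Rightarrow>\<^sub>0 nat) set \<Rightarrow> bool"
  where "up_closed V \<longleftrightarrow> (\<forall>s t. s \<in> V \<longrightarrow> s \<preceq> t \<longrightarrow> t \<in> V)"

definition min_exps :: "('a \<Rightarrow>\<^sub>0 nat) set \<Rightarrow> ('a \<Rightarrow>\<^sub>0 nat) set"
  where "min_exps E = {t \<in> E. \<forall>s\<in>E. s \<preceq> t \<longrightarrow> s = t}"

lemma ex_min_exp:
  fixes E :: "('n::finite \<Rightarrow>\<^sub>0 nat) set"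
  assumes "t \<in> E"
  shows "\<exists>g\<in>min_exps E. g \<preceq> t"
  using assms
proof (induction "total_deg t" arbitrary: t rule: less_induct)
  case less
  show ?case
  proof (cases "t \<in> min_exps E")
    case False
    then obtain s where "s \<in> E" "s \<preceq> t" "s \<noteq> t" using less.prems by (auto simp: min_exps_def)
    with less.hyps[of s] total_deg_strict_mono[of s t] show ?thesis by (meson exp_le_trans)
  qed (auto intro: bexI[of _ t])
qed


text \<open>
  The order of the generators is given by an injective rank. The last condition says that the
  variables in \<open>colon_vars G r v\<close> generate the colon ideal of the earlier generators by \<open>v\<close>.
\<close>

definition lq_rank :: "('a \<Rightarrow>\<^sub>0 nat) set \<Rightarrow> (('a \<Rightarrow>\<^sub>0 nat) \<Rightarrow> nat) \<Rightarrow> bool"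
  where "lq_rank G r \<longleftrightarrow> finite G \<and> inj_on r G \<and> (\<forall>u\<in>G. \<forall>v\<in>G. u \<preceq> v \<longrightarrow> u = v) \<and>
    (\<forall>u\<in>G. \<forall>v\<in>G. r u < r v \<longrightarrow>
       (\<exists>w\<in>G. \<exists>a. r w < r v \<and> w \<preceq> v + unit_exp a \<and> lookup v a < lookup u a))"

definition colon_vars :: "('a \<Rightarrow>\<^sub>0 nat) set \<Rightarrow> (('a \<Rightarrow>\<^sub>0 nat) \<Rightarrow> nat) \<Rightarrow> ('a \<Rightarrow>\<^sub>0 nat) \<Rightarrow> 'a set"
  where "colon_vars G r v = {a. \<exists>w\<in>G. r w < r v \<and> w \<preceq> v + unit_exp a}"

lemma lq_rankD:
  assumes "lq_rank G r" "u \<in> G" "v \<in> G" "r u < r v"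
  obtains w a where "w \<in> G" "r w < r v" "w \<preceq> v + unit_exp a" "lookup v a < lookup u a"
  using assms unfolding lq_rank_def by blast

lemma lq_rank_antichain: "lq_rank G r \<Longrightarrow> u \<in> G \<Longrightarrow> v \<in> G \<Longrightarrow> u \<preceq> v \<Longrightarrow> u = v"
  unfolding lq_rank_def by blast

lemma lq_rank_total_deg_le:
  assumes "lq_rank G r" "w \<in> G" "v \<in> G" "w \<noteq> v" "w \<preceq> v + unit_exp a"
  shows "total_deg w \<le> total_deg v"
proof -
  have "w \<noteq> v + unit_exp a"
    using lq_rank_antichain[OF assms(1,3,2)] assms(4) by auto
  hence "total_deg w < total_deg (v + unit_exp a)"
    using assms(5) by (intro total_deg_strict_mono)
  thus ?thesis by simp
qed

text \<open>Let \<open>u\<close> come before \<open>v\<close> in the new order. If it also did in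
  the old one, the old witness has degree at most \<open>deg v\<close> and a smaller old rank, hence
  still precedes \<open>v\<close>. Otherwise \<open>deg u < deg v\<close>, and an induction along
  the old order replaces \<open>u\<close> by earlier generators until the first case
  applies.\<close>

lemma lq_rank_sort:
  fixes G :: "('n::finite \<Rightarrow>\<^sub>0 nat) set"
  assumes lq: "lq_rank G r"
  obtains r' where "lq_rank G r'"
    "\<And>u v. u \<in> G \<Longrightarrow> v \<in> G \<Longrightarrow> r' u < r' v \<Longrightarrow> total_deg u \<le> total_deg v"
proof -
  have fin: "finite G" and inj: "inj_on r G" using lq by (auto simp: lq_rank_def)
  obtain N where N: "\<And>t. t \<in> G \<Longrightarrow> r t < N"
    using finite_nat_set_iff_bounded[of "r ` G"] fin by auto
  \<comment> \<open>Lexicographic comparison by degree and then by old rank, encoded in one number;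
    \<open>r t < N\<close> keeps the two digits apart.\<close>
  define r' where "r' t = total_deg t * N + r t" for t
  have r': "r' u < r' v \<longleftrightarrow> total_deg u < total_deg v \<or> (total_deg u = total_deg v \<and> r u < r v)"
    if "u \<in> G" "v \<in> G" for u v
  proof -
    have *: "r' x < r' y" if "x \<in> G" "y \<in> G" "total_deg x < total_deg y" for x y
    proof -
      have "r' x < Suc (total_deg x) * N" using N[OF \<open>x \<in> G\<close>] by (simp add: r'_def)
      also have "\<dots> \<le> total_deg y * N" using that(3) by (intro mult_le_mono1) simp
      also have "\<dots> \<le> r' y" by (simp add: r'_def)
      finally show ?thesis .
    qed
    show ?thesis
    proof (cases "total_deg u" "total_deg v" rule: linorder_cases)
      case less
      then show ?thesis using *[of u v] that by simp
    next
      case equal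
      then show ?thesis by (simp add: r'_def)
    next
      case greater
      then show ?thesis using *[of v u] that by simp
    qed
  qed
  have earlier: "\<exists>w\<in>G. \<exists>a. r' w < r' v \<and> w \<preceq> v + unit_exp a \<and> lookup v a < lookup u a"
    if uv: "u \<in> G" "v \<in> G" "r u < r v" for u v
  proof -
    obtain w a where w: "w \<in> G" "r w < r v" "w \<preceq> v + unit_exp a" "lookup v a < lookup u a"
      using lq_rankD[OF lq uv] .
    moreover have "total_deg w \<le> total_deg v"
      using lq_rank_total_deg_le[OF lq \<open>w \<in> G\<close> \<open>v \<in> G\<close> _ w(3)] w(2) by auto
    hence "r' w < r' v" using r' uv w by auto
    ultimately show ?thesis by blast
  qed
  have later: "\<exists>w\<in>G. \<exists>a. r' w < r' v \<and> w \<preceq> v + unit_exp a \<and> lookup v a < lookup u a"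
    if "u \<in> G" "v \<in> G" "total_deg u < total_deg v" "r v < r u" for u v
    using that
  proof (induction "r u" arbitrary: u rule: less_induct)
    case less
    \<comment> \<open>The roles are exchanged: \<open>v\<close> is the earlier generator here and
      \<open>u\<close> the later one. The witness \<open>w\<close> has degree at most
      \<open>deg u\<close>, so it is still of smaller degree than \<open>v\<close>.\<close>
    obtain w a where w: "w \<in> G" "r w < r u" "w \<preceq> u + unit_exp a" "lookup u a < lookup v a"
      using lq_rankD[OF lq less.prems(2,1,4)] .
    have dw: "total_deg w \<le> total_deg u"
      using lq_rank_total_deg_le[OF lq \<open>w \<in> G\<close> \<open>u \<in> G\<close> _ w(3)] w(2) by auto
    have "w \<noteq> v" using dw less.prems by auto
    hence "r w \<noteq> r v" using inj w(1) less.prems by (auto dest: inj_onD)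
    hence "\<exists>z\<in>G. \<exists>b. r' z < r' v \<and> z \<preceq> v + unit_exp b \<and> lookup v b < lookup w b"
      using earlier[of w v] less.hyps[of w] w less.prems dw by (cases "r w < r v") auto
    then obtain z b where z: "z \<in> G" "r' z < r' v" "z \<preceq> v + unit_exp b" "lookup v b < lookup w b"
      by blast
    have "lookup w b \<le> lookup u b + (if b = a then 1 else 0)"
      using w(3)[unfolded exp_le_def, rule_format, of b] by (auto simp: lookup_add lookup_unit_exp)
    \<comment> \<open>The index \<open>b\<close> is not \<open>a\<close>: there the exponent of
      \<open>w\<close> is at most one more than that of \<open>u\<close>, hence at most that of
      \<open>v\<close>. Elsewhere \<open>w\<close> does not exceed \<open>u\<close>.\<close>
    hence "lookup v b < lookup u b" using z(4) w(4) by (auto split: if_splits)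
    with z show ?case by blast
  qed
  have "inj_on r' G"
  proof (rule inj_onI)
    fix x y assume xy: "x \<in> G" "y \<in> G" "r' x = r' y"
    hence "total_deg x = total_deg y" using r'[of x y] r'[of y x]
      by (metis less_irrefl linorder_neqE_nat)
    hence "r x = r y" using xy by (simp add: r'_def)
    thus "x = y" using inj xy by (auto dest: inj_onD)
  qed
  moreover have "\<exists>w\<in>G. \<exists>a. r' w < r' v \<and> w \<preceq> v + unit_exp a \<and> lookup v a < lookup u a"
    if "u \<in> G" "v \<in> G" "r' u < r' v" for u v
  proof (cases "r u < r v")
    case True
    thus ?thesis using earlier that by blast
  next
    case False
    hence "total_deg u < total_deg v" using that r' by auto
    moreover from this have "r u \<noteq> r v" using inj that by (auto dest: inj_onD)
    ultimately show ?thesis using later False that by auto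
  qed
  ultimately have "lq_rank G r'"
    using lq unfolding lq_rank_def by blast
  thus thesis using that[of r'] r' by fastforce
qed


section \<open>Partitions into cones\<close>

text \<open>The exponents of the monomials in the Stanley space \<open>m K[Z]\<close>.\<close>

definition cone :: "('a \<Rightarrow>\<^sub>0 nat) \<Rightarrow> 'a set \<Rightarrow> ('a \<Rightarrow>\<^sub>0 nat) set"
  where "cone m Z = {t. m \<preceq> t \<and> (\<forall>i. i \<notin> Z \<longrightarrow> lookup t i = lookup m i)}"

text \<open>Finite disjoint unions of cones of dimension at least \<open>k\<close>. In this form
  sets are cut and glued by set equations alone.\<close>

inductive cone_partitionable :: "nat \<Rightarrow> ('a \<Rightarrow>\<^sub>0 nat) set \<Rightarrow> bool" for k where
  empty: "cone_partitionable k {}"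
| cone: "k \<le> card Z \<Longrightarrow> cone_partitionable k (cone m Z)"
| disjoint_Un: "cone_partitionable k A \<Longrightarrow> cone_partitionable k B \<Longrightarrow> A \<inter> B = {} \<Longrightarrow>
    cone_partitionable k (A \<union> B)"

text \<open>A half-space \<open>d \<le> t_a\<close> meets a cone in everything, in nothing, or, if
  \<open>a\<close> is a free direction, in the cone with its apex raised to height \<open>d\<close>;
  the dimension never drops.\<close>

lemma cone_partitionable_restrict:
  assumes "cone_partitionable k V"
  shows "cone_partitionable k {t \<in> V. d \<le> lookup t a}"
  using assms
proof (induction rule: cone_partitionable.induct)
  case empty
  then show ?case by (simp add: cone_partitionable.empty)
next
  case (cone Z m)
  show ?case
  proof (cases "d \<le> lookup m a")
    case True
    hence "{t \<in> cone m Z. d \<le> lookup t a} = cone m Z"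
      by (auto simp: cone_def exp_le_def intro: order_trans)
    with cone show ?thesis by (simp add: cone_partitionable.cone)
  next
    case False
    show ?thesis
    proof (cases "a \<in> Z")
      case True
      let ?m = "m + Poly_Mapping.single a (d - lookup m a)"
      have l: "lookup ?m i = (if i = a then d else lookup m i)" for i
        using False by (simp add: lookup_add lookup_single when_def)
      have "{t \<in> cone m Z. d \<le> lookup t a} = cone ?m Z"
      proof (intro equalityI subsetI)
        fix t assume t: "t \<in> {t \<in> cone m Z. d \<le> lookup t a}"
        thus "t \<in> cone ?m Z" using True by (auto simp: cone_def exp_le_def l)
      next
        fix t assume t: "t \<in> cone ?m Z"
        have "lookup m i \<le> lookup t i" for i
          using t False by (cases "i = a") (auto simp: cone_def exp_le_def l dest!: spec[of _ i])
        moreover have "d \<le> lookup t a"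
          using t by (auto simp: cone_def exp_le_def l dest!: spec[of _ a])
        ultimately show "t \<in> {t \<in> cone m Z. d \<le> lookup t a}"
          using t True by (auto simp: cone_def exp_le_def l)
      qed
      with cone show ?thesis by (simp add: cone_partitionable.cone)
    next
      case notin: False
      hence "{t \<in> cone m Z. d \<le> lookup t a} = {}"
        using False by (auto simp: cone_def)
      thus ?thesis using cone_partitionable.empty by metis
    qed
  qed
next
  case (disjoint_Un A B)
  have "{t \<in> A \<union> B. d \<le> lookup t a} = {t \<in> A. d \<le> lookup t a} \<union> {t \<in> B. d \<le> lookup t a}"
    by auto
  thus ?case using disjoint_Un by (auto intro!: cone_partitionable.disjoint_Un)
qed

text \<open>As long as some free direction \<open>i\<close> has \<open>m_i < u_i\<close>, the face
  of the cone at height \<open>m_i\<close> contains no multiple of \<open>u\<close>. It is split off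
  as a cone of one dimension less, and the apex moves up by \<open>x_i\<close>, which lowers the
  degree of \<open>u - m\<close>.\<close>

lemma cone_partitionable_diff:
  fixes m u :: "'n::finite \<Rightarrow>\<^sub>0 nat"
  assumes "Suc k \<le> card Z"
  shows "cone_partitionable k {t \<in> cone m Z. \<not> u \<preceq> t}"
proof (induction "total_deg (u - m)" arbitrary: m rule: less_induct)
  case less
  show ?case
  proof (cases "\<exists>i\<in>Z. lookup m i < lookup u i")
    case True
    then obtain i where i: "i \<in> Z" "lookup m i < lookup u i" by blast
    let ?m = "m + unit_exp i"
    have l: "lookup ?m j = (if j = i then Suc (lookup m i) else lookup m j)" for j
      by (simp add: lookup_add lookup_unit_exp)
    have "u - m = (u - ?m) + unit_exp i"
      using i(2) by (intro poly_mapping_eqI) (auto simp: lookup_add lookup_minus lookup_unit_exp)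
    hence "total_deg (u - m) = Suc (total_deg (u - ?m))"
      by (simp only: total_deg_add total_deg_unit_exp)
    hence "cone_partitionable k {t \<in> cone ?m Z. \<not> u \<preceq> t}"
      by (intro less.hyps) simp
    moreover have "cone_partitionable k (cone m (Z - {i}))"
      using assms i by (intro cone_partitionable.cone) simp
    moreover have "{t \<in> cone m Z. \<not> u \<preceq> t} = cone m (Z - {i}) \<union> {t \<in> cone ?m Z. \<not> u \<preceq> t}"
    proof (intro equalityI subsetI)
      fix t assume t: "t \<in> {t \<in> cone m Z. \<not> u \<preceq> t}"
      show "t \<in> cone m (Z - {i}) \<union> {t \<in> cone ?m Z. \<not> u \<preceq> t}"
      proof (cases "lookup t i = lookup m i")
        case True
        hence "t \<in> cone m (Z - {i})" using t by (auto simp: cone_def)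
        thus ?thesis by blast
      next
        case False
        hence "Suc (lookup m i) \<le> lookup t i" using t
          by (auto simp: cone_def exp_le_def Suc_le_eq le_neq_implies_less)
        hence "t \<in> cone ?m Z" using t i(1) by (auto simp: cone_def exp_le_def l)
        thus ?thesis using t by blast
      qed
    next
      fix t assume "t \<in> cone m (Z - {i}) \<union> {t \<in> cone ?m Z. \<not> u \<preceq> t}"
      thus "t \<in> {t \<in> cone m Z. \<not> u \<preceq> t}"
      proof
        assume t: "t \<in> cone m (Z - {i})"
        hence "lookup t i < lookup u i" using i by (simp add: cone_def)
        hence "\<not> u \<preceq> t" by (auto simp: exp_le_def not_le)
        thus ?thesis using t by (auto simp: cone_def)
      next
        assume t: "t \<in> {t \<in> cone ?m Z. \<not> u \<preceq> t}"
        hence "m \<preceq> t" using exp_le_trans[of m ?m t] by (auto simp: cone_def)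
        thus ?thesis using t i by (auto simp: cone_def l)
      qed
    qed
    moreover have "cone m (Z - {i}) \<inter> {t \<in> cone ?m Z. \<not> u \<preceq> t} = {}"
    proof -
      have "lookup t i = lookup m i" if "t \<in> cone m (Z - {i})" for t
        using that by (simp add: cone_def)
      moreover have "Suc (lookup m i) \<le> lookup t i" if "t \<in> cone ?m Z" for t
        using that l[of i] unfolding cone_def exp_le_def mem_Collect_eq by metis
      ultimately show ?thesis by fastforce
    qed
    ultimately show ?thesis by (simp add: cone_partitionable.disjoint_Un)
  next
    case False
    show ?thesis
    proof (cases "u \<preceq> m")
      case True
      hence "{t \<in> cone m Z. \<not> u \<preceq> t} = {}" by (auto simp: cone_def intro: exp_le_trans)
      thus ?thesis using cone_partitionable.empty by metis
    next
      case nle: False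
      \<comment> \<open>All free directions have caught up with \<open>u\<close>, so this
        \<open>i\<close> is outside \<open>Z\<close>; the whole cone stays at \<open>m_i\<close>
        there and contains no multiple of \<open>u\<close>.\<close>
      then obtain i where "lookup m i < lookup u i" by (auto simp: exp_le_def not_le)
      with False have "{t \<in> cone m Z. \<not> u \<preceq> t} = cone m Z"
        by (auto simp: cone_def exp_le_def) (metis not_le)
      thus ?thesis using assms by (simp add: cone_partitionable.cone)
    qed
  qed
qed

lemma cone_UNIV: "cone 0 UNIV = UNIV"
  by (auto simp: cone_def exp_le_def)

text \<open>The slab consists of the layers at heights \<open>0,...,d\<close> over \<open>a\<close>.
  Each is a cone of dimension \<open>n - 1\<close>, and removing the multiples of \<open>v\<close>
  costs one more, whence \<open>k + 2 \<le> n\<close>.\<close>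

lemma cone_partitionable_slab:
  fixes v :: "'n::finite \<Rightarrow>\<^sub>0 nat"
  assumes "k + 2 \<le> CARD('n)"
  shows "cone_partitionable k {t. lookup t a \<le> d \<and> \<not> v \<preceq> t}"
proof (induction d)
  case 0
  have "{t. lookup t a \<le> 0 \<and> \<not> v \<preceq> t} = {t \<in> cone 0 (UNIV - {a}). \<not> v \<preceq> t}"
    by (auto simp: cone_def exp_le_def)
  thus ?case using assms cone_partitionable_diff[of k "UNIV - {a}" 0 v]
    by (simp add: card_Diff_singleton)
next
  case (Suc d)
  let ?m = "Poly_Mapping.single a (Suc d)"
  have "{t. lookup t a \<le> Suc d \<and> \<not> v \<preceq> t}
    = {t. lookup t a \<le> d \<and> \<not> v \<preceq> t} \<union> {t \<in> cone ?m (UNIV - {a}). \<not> v \<preceq> t}"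
    by (auto simp: cone_def exp_le_def lookup_single when_def le_Suc_eq)
  moreover have "{t. lookup t a \<le> d \<and> \<not> v \<preceq> t} \<inter> {t \<in> cone ?m (UNIV - {a}). \<not> v \<preceq> t} = {}"
    by (auto simp: cone_def)
  moreover have "cone_partitionable k {t \<in> cone ?m (UNIV - {a}). \<not> v \<preceq> t}"
    using assms by (intro cone_partitionable_diff) (simp add: card_Diff_singleton)
  ultimately show ?case using Suc by (simp add: cone_partitionable.disjoint_Un)
qed

lemma cone_partitionable_lq:
  fixes G :: "('n::finite \<Rightarrow>\<^sub>0 nat) set"
  assumes lq: "lq_rank G r" and k: "k + 2 \<le> CARD('n)"
    and single: "\<And>v a c. v \<in> G \<Longrightarrow> a \<in> colon_vars G r v \<Longrightarrow> c \<in> colon_vars G r v \<Longrightarrow> a = c"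
  shows "cone_partitionable k {t. \<not> (\<exists>g\<in>G. g \<preceq> t)}"
proof -
  have inj: "inj_on r G" and fin: "finite G" using lq by (auto simp: lq_rank_def)
  have "cone_partitionable k {t. \<not> (\<exists>g\<in>G. r g < N \<and> g \<preceq> t)}" for N
  proof (induction N)
    case 0
    have "cone_partitionable k (cone 0 (UNIV :: 'n set))"
      using k by (intro cone_partitionable.cone) simp
    thus ?case by (simp add: cone_UNIV)
  next
    case (Suc N)
    show ?case
    proof (cases "\<exists>v\<in>G. r v = N")
      case False
      hence "{t. \<not> (\<exists>g\<in>G. r g < Suc N \<and> g \<preceq> t)} = {t. \<not> (\<exists>g\<in>G. r g < N \<and> g \<preceq> t)}"
        by (auto simp: less_Suc_eq)
      thus ?thesis using Suc by simp
    next
      case True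
      then obtain v where v: "v \<in> G" "r v = N" by blast
      hence eq: "{t. \<not> (\<exists>g\<in>G. r g < Suc N \<and> g \<preceq> t)}
          = {t. \<not> (\<exists>g\<in>G. r g < N \<and> g \<preceq> t) \<and> \<not> v \<preceq> t}"
        using inj by (auto simp: less_Suc_eq dest: inj_onD)
      show ?thesis
      proof (cases "\<exists>u\<in>G. r u < N")
        case False
        hence "{t. \<not> (\<exists>g\<in>G. r g < Suc N \<and> g \<preceq> t)} = {t \<in> cone 0 UNIV. \<not> v \<preceq> t}"
          using eq by (auto simp: cone_UNIV)
        thus ?thesis using k cone_partitionable_diff[of k UNIV 0 v] by simp
      next
        case True
        then obtain u0 where u0: "u0 \<in> G" "r u0 < N" by blast
        obtain w a where w: "w \<in> G" "r w < r v" "w \<preceq> v + unit_exp a"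
          using lq_rankD[OF lq u0(1) v(1) u0(2)[folded v(2)]] by blast
        have a: "a \<in> colon_vars G r v" using w by (auto simp: colon_vars_def)
        \<comment> \<open>Each earlier \<open>u\<close> supplies a colon variable at which it
          exceeds \<open>v\<close>; as there is only one colon variable, it is \<open>a\<close> for
          every \<open>u\<close>.\<close>
        have gt: "lookup v a < lookup u a" if uN: "u \<in> G" "r u < N" for u
        proof -
          obtain z c where z: "z \<in> G" "r z < r v" "z \<preceq> v + unit_exp c" "lookup v c < lookup u c"
            using lq_rankD[OF lq uN(1) v(1) uN(2)[folded v(2)]] by blast
          have "c \<in> colon_vars G r v" using z by (auto simp: colon_vars_def)
          thus ?thesis using single[OF v(1) a, of c] z(4) by simp
        qed
        let ?A = "{t. lookup t a \<le> lookup v a \<and> \<not> v \<preceq> t}"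
        let ?B = "{t \<in> {t. \<not> (\<exists>g\<in>G. r g < N \<and> g \<preceq> t)}. Suc (lookup v a) \<le> lookup t a}"
        have "w \<preceq> t" if "v \<preceq> t" "lookup v a < lookup t a" for t
        proof -
          have "v + unit_exp a \<preceq> t"
            using that by (auto simp: exp_le_def lookup_add lookup_unit_exp)
          with w(3) show ?thesis by (rule exp_le_trans)
        qed
        note * = this
        have "lookup v a < lookup t a" if "g \<in> G" "r g < N" "g \<preceq> t" for g t
          using gt[OF that(1,2)] that(3) unfolding exp_le_def by (meson less_le_trans)
        hence "{t. \<not> (\<exists>g\<in>G. r g < Suc N \<and> g \<preceq> t)} = ?A \<union> ?B"
          unfolding eq using * w(1,2) v(2) by (auto simp: not_le Suc_le_eq) (meson leD leI)+
        moreover have "?A \<inter> ?B = {}" by auto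
        ultimately show ?thesis
          using cone_partitionable_slab[OF k] cone_partitionable_restrict[OF Suc.IH]
          by (simp add: cone_partitionable.disjoint_Un)
      qed
    qed
  qed
  moreover obtain N where "\<And>t. t \<in> G \<Longrightarrow> r t < N"
    using finite_nat_set_iff_bounded[of "r ` G"] fin by auto
  hence "{t. \<not> (\<exists>g\<in>G. g \<preceq> t)} = {t. \<not> (\<exists>g\<in>G. r g < N \<and> g \<preceq> t)}" by blast
  ultimately show ?thesis by simp
qed

text \<open>Counting list positions, instead of stating membership, also excludes a nonempty overlap
  between equal entries, as a direct sum requires.\<close>

lemma cone_partitionable_list:
  assumes "cone_partitionable k V"
  obtains D where "\<And>m Z. (m, Z) \<in> set D \<Longrightarrow> k \<le> card Z"
    "\<And>t. length (filter (\<lambda>(m, Z). t \<in> cone m Z) D) = (if t \<in> V then 1 else 0)"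
proof -
  have "\<exists>D. (\<forall>(m, Z) \<in> set D. k \<le> card Z) \<and>
     (\<forall>t. length (filter (\<lambda>(m, Z). t \<in> cone m Z) D) = (if t \<in> V then 1 else 0))"
    using assms
  proof (induction rule: cone_partitionable.induct)
    case empty
    show ?case by (rule exI[of _ "[]"]) simp
  next
    case (cone Z m)
    thus ?case by (intro exI[of _ "[(m, Z)]"]) simp
  next
    case (disjoint_Un A B)
    obtain D1 where D1: "\<forall>(m, Z) \<in> set D1. k \<le> card Z"
      "\<And>t. length (filter (\<lambda>(m, Z). t \<in> cone m Z) D1) = (if t \<in> A then 1 else 0)"
      using disjoint_Un.IH(1) by blast
    obtain D2 where D2: "\<forall>(m, Z) \<in> set D2. k \<le> card Z"
      "\<And>t. length (filter (\<lambda>(m, Z). t \<in> cone m Z) D2) = (if t \<in> B then 1 else 0)"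
      using disjoint_Un.IH(2) by blast
    show ?case
      using D1 D2 \<open>A \<inter> B = {}\<close> by (intro exI[of _ "D1 @ D2"]) auto
  qed
  then obtain D where D: "\<forall>(m, Z) \<in> set D. k \<le> card Z"
    "\<And>t. length (filter (\<lambda>(m, Z). t \<in> cone m Z) D) = (if t \<in> V then 1 else 0)"
    by blast
  show thesis by (rule that[of D]) (use D in auto)
qed


section \<open>Monomial ideals\<close>

lemma lookup_single_times:
  fixes s :: "'n \<Rightarrow>\<^sub>0 nat" and f :: "('n, 'k::field) mpoly"
  shows "lookup (Poly_Mapping.single s c * f) t
    = (if s \<preceq> t then c * lookup f (t - s) else 0)"
proof -
  have "lookup (Poly_Mapping.single s c * f) t
      = c * (\<Sum>q. lookup f q when t = s + q)"
    by (simp add: lookup_mult lookup_single when_mult)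
  also have "\<dots> = (if s \<preceq> t then c * lookup f (t - s) else 0)"
  proof (cases "s \<preceq> t")
    case True
    have "(t = s + q) \<longleftrightarrow> (q = t - s)" for q
      using exp_le_diff[OF True] by (metis add_left_cancel)
    thus ?thesis using True by simp
  next
    case False
    hence "t \<noteq> s + q" for q by auto
    thus ?thesis using False by simp
  qed
  finally show ?thesis .
qed

lemma lookup_monomial_times:
  "lookup (monomial s * f) t
    = (if s \<preceq> t then lookup f (t - s) else 0)"
  unfolding monomial_def lookup_single_times by simp

lemma lookup_monomial:
  "lookup (monomial s) t = (if s = t then 1 else 0)"
  by (simp add: monomial_def lookup_single when_def)

lemma monomial_add: "monomial (s + t) = monomial s * monomial t"
  by (simp add: monomial_def mult_single)

lemma monomial_0 [simp]: "monomial 0 = 1"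
  by (simp add: monomial_def)

lemma keys_monomial [simp]: "keys (monomial t :: ('n, 'k::field) mpoly) = {t}"
  by (simp add: monomial_def)

lemma inj_monomial: "inj (monomial :: _ \<Rightarrow> ('n, 'k::field) mpoly)"
  by (rule injI) (metis keys_monomial singleton_inject)

lemma variable_eq: "variable i = monomial (unit_exp i)"
  by (simp add: variable_def unit_exp_def)

lemma single_eq_times_monomial: "Poly_Mapping.single t c = Poly_Mapping.single 0 c * monomial t"
  by (simp add: monomial_def mult_single)

lemma mpoly_eq_sum: "f = (\<Sum>t\<in>keys f. Poly_Mapping.single t (lookup f t))"
proof (rule poly_mapping_eqI)
  fix k
  show "lookup f k
    = lookup (\<Sum>t\<in>keys f. Poly_Mapping.single t (lookup f t)) k"
    by (cases "k \<in> keys f")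
      (auto simp: lookup_sum lookup_single when_def sum.delta in_keys_iff)
qed

lemma is_ideal_memI:
  assumes "is_ideal J" "\<And>t. t \<in> keys f \<Longrightarrow> monomial t \<in> J"
  shows "f \<in> J"
proof -
  have "(\<Sum>t\<in>keys f. Poly_Mapping.single t (lookup f t)) \<in> J"
  proof (rule is_ideal_sum[OF assms(1)])
    fix t assume "t \<in> keys f"
    thus "Poly_Mapping.single t (lookup f t) \<in> J"
      using assms by (subst single_eq_times_monomial) (auto intro: is_ideal_mult)
  qed
  thus ?thesis using mpoly_eq_sum[of f] by simp
qed

text \<open>An ideal only if \<open>V\<close> is upward closed; also used for other sets \<open>V\<close>.\<close>

definition supp_ideal :: "('n \<Rightarrow>\<^sub>0 nat) set \<Rightarrow> ('n, 'k::field) mpoly set"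
  where "supp_ideal V = {f. keys f \<subseteq> V}"

lemma monomial_mem_supp_ideal [simp]: "monomial t \<in> supp_ideal V \<longleftrightarrow> t \<in> V"
  by (simp add: supp_ideal_def)

lemma is_ideal_supp_ideal:
  assumes "up_closed V"
  shows "is_ideal (supp_ideal V :: ('n, 'k::field) mpoly set)"
proof (rule is_idealI)
  show "x + y \<in> supp_ideal V" if "x \<in> supp_ideal V" "y \<in> supp_ideal V" for x y :: "('n, 'k) mpoly"
    using that Poly_Mapping.keys_add[of x y] by (auto simp: supp_ideal_def)
  show "r * x \<in> supp_ideal V" if "x \<in> supp_ideal V" for r x :: "('n, 'k) mpoly"
  proof -
    have "\<exists>p q. t = p + q \<and> q \<in> V" if "t \<in> keys (r * x)" for t
      using keys_mult[of r x] that \<open>x \<in> supp_ideal V\<close> by (force simp: supp_ideal_def)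
    thus ?thesis using assms by (auto simp: supp_ideal_def up_closed_def) (metis exp_le_add(2))
  qed
qed (simp add: supp_ideal_def)

definition up_closure :: "('a \<Rightarrow>\<^sub>0 nat) set \<Rightarrow> ('a \<Rightarrow>\<^sub>0 nat) set"
  where "up_closure T = {t. \<exists>s\<in>T. s \<preceq> t}"

lemma up_closed_up_closure [simp]: "up_closed (up_closure T)"
  by (auto simp: up_closed_def up_closure_def intro: exp_le_trans)

lemma up_closure_mono: "S \<subseteq> T \<Longrightarrow> up_closure S \<subseteq> up_closure T"
  by (auto simp: up_closure_def)

lemma subset_up_closure: "T \<subseteq> up_closure T"
  unfolding up_closure_def using exp_le_refl by blast

lemma supp_ideal_mono: "S \<subseteq> T \<Longrightarrow> supp_ideal S \<subseteq> supp_ideal T"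
  by (auto simp: supp_ideal_def)

text \<open>Polynomials whose terms are all multiples of elements of \<open>T\<close> form an ideal,
  and each such term lies in the generated ideal. Membership in a monomial ideal is thereby decided
  term by term.\<close>

lemma ideal_of_monomials:
  "ideal_of (monomial ` T) = (supp_ideal (up_closure T) :: ('n, 'k::field) mpoly set)"
proof
  show "ideal_of (monomial ` T) \<subseteq> (supp_ideal (up_closure T) :: ('n, 'k) mpoly set)"
    by (rule ideal_of_minimal[OF is_ideal_supp_ideal]) (auto simp: subset_up_closure[THEN subsetD])
  show "supp_ideal (up_closure T) \<subseteq> (ideal_of (monomial ` T) :: ('n, 'k) mpoly set)"
  proof
    fix f :: "('n, 'k) mpoly" assume f: "f \<in> supp_ideal (up_closure T)"
    show "f \<in> ideal_of (monomial ` T)"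
    proof (rule is_ideal_memI[OF ideal_of_is_ideal])
      fix t assume "t \<in> keys f"
      then obtain s where "s \<in> T" "s \<preceq> t" using f by (auto simp: supp_ideal_def up_closure_def)
      hence "monomial t = monomial (t - s) * (monomial s :: ('n, 'k) mpoly)"
        by (metis exp_le_diff monomial_add mult.commute)
      thus "monomial t \<in> (ideal_of (monomial ` T) :: ('n, 'k) mpoly set)"
        using \<open>s \<in> T\<close> subset_ideal_of[of "monomial ` T"]
        by (auto intro!: is_ideal_mult[OF ideal_of_is_ideal])
    qed
  qed
qed

lemma monomial_ideal_eq_supp_ideal:
  fixes I :: "('n, 'k::field) mpoly set"
  assumes "monomial_ideal I"
  obtains E where "up_closed E" "I = supp_ideal E"
proof -
  obtain A where A: "A \<subseteq> range monomial" "I = ideal_of A"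
    using assms by (auto simp: monomial_ideal_def)
  then obtain T where "A = monomial ` T" by (auto simp: subset_image_iff)
  with A that[of "up_closure T"] show thesis by (simp add: ideal_of_monomials)
qed

lemma monomial_dvd_iff:
  "(monomial s :: ('n, 'k::field) mpoly) divides\<^bsub>mpoly_ring\<^esub> monomial t \<longleftrightarrow> s \<preceq> t"
proof
  assume "(monomial s :: ('n, 'k) mpoly) divides\<^bsub>mpoly_ring\<^esub> monomial t"
  then obtain c :: "('n, 'k) mpoly" where c: "monomial t = monomial s * c"
    by (auto simp: factor_def)
  hence "lookup (monomial s * c) t = 1" by (metis lookup_monomial)
  thus "s \<preceq> t" by (simp add: lookup_monomial_times split: if_splits)
next
  assume "s \<preceq> t"
  thus "(monomial s :: ('n, 'k) mpoly) divides\<^bsub>mpoly_ring\<^esub> monomial t"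
    by (auto simp: factor_def intro!: exI[of _ "monomial (t - s)"])
      (metis exp_le_diff monomial_add)
qed

lemma min_gens_supp_ideal:
  "min_gens (supp_ideal E :: ('n, 'k::field) mpoly set) = monomial ` min_exps E"
proof -
  have *: "(\<forall>v\<in>supp_ideal E \<inter> range monomial. P v) \<longleftrightarrow> (\<forall>s\<in>E. P (monomial s))"
    for P :: "('n, 'k) mpoly \<Rightarrow> bool"
    by auto
  have "monomial t \<in> min_gens (supp_ideal E :: ('n, 'k) mpoly set) \<longleftrightarrow> t \<in> min_exps E" for t
    unfolding min_gens_def min_exps_def mem_Collect_eq *
    by (auto simp: monomial_dvd_iff inj_eq[OF inj_monomial])
  moreover have "min_gens (supp_ideal E :: ('n, 'k) mpoly set) \<subseteq> range monomial"
    by (auto simp: min_gens_def)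
  ultimately show ?thesis by blast
qed

lemma up_closure_min_exps:
  fixes E :: "('n::finite \<Rightarrow>\<^sub>0 nat) set"
  assumes "up_closed E"
  shows "up_closure (min_exps E) = E"
  using assms ex_min_exp by (fastforce simp: up_closure_def up_closed_def min_exps_def)

text \<open>The rank is the position in the list. For an earlier \<open>u\<close>, the monomial
  \<open>u / gcd(u, v)\<close> lies in the colon ideal and is thus divisible by one of its variables
  \<open>x_a\<close>; then \<open>u\<close> exceeds \<open>v\<close> at \<open>a\<close>, and
  \<open>x_a v\<close> is a multiple of an earlier \<open>w\<close>.\<close>

lemma linear_quotients_lq_rank:
  fixes E :: "('n::finite \<Rightarrow>\<^sub>0 nat) set"
  assumes "has_linear_quotients (supp_ideal E :: ('n, 'k::field) mpoly set)"
  obtains r where "lq_rank (min_exps E) r"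
proof -
  obtain us :: "('n, 'k) mpoly list" where us: "distinct us" "set us = monomial ` min_exps E"
    "\<And>j. 1 \<le> j \<Longrightarrow> j < length us \<Longrightarrow> \<exists>Z. colon_ideal mpoly_ring (ideal_of (set (take j us))) (us ! j)
             = ideal_of (variable ` Z)"
    using assms by (auto simp: has_linear_quotients_def min_gens_supp_ideal)
  obtain ts where us_eq: "us = map monomial ts"
    using us(2) ex_map_conv[of us monomial] by auto
  have ts: "distinct ts" "set ts = min_exps E"
  proof -
    show "distinct ts" using us(1) by (simp add: us_eq distinct_map)
    show "set ts = min_exps E"
      using us(2) by (simp add: us_eq inj_image_eq_iff[OF inj_monomial])
  qed
  define r where "r t = (THE i. i < length ts \<and> ts ! i = t)" for t
  have r: "r (ts ! i) = i" if "i < length ts" for i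
    unfolding r_def using that ts(1) by (auto simp: nth_eq_iff_index_eq)
  have "\<exists>w\<in>min_exps E. \<exists>a. r w < r v \<and> w \<preceq> v + unit_exp a \<and> lookup v a < lookup u a"
    if uv: "u \<in> min_exps E" "v \<in> min_exps E" "r u < r v" for u v
  proof -
    obtain i j where ij: "i < length ts" "u = ts ! i" "j < length ts" "v = ts ! j"
      using uv ts(2) by (metis in_set_conv_nth)
    have "i < j" using uv(3) ij r by simp
    have take: "set (take j us) = monomial ` set (take j ts)" by (simp add: us_eq take_map)
    have mem: "monomial s \<in> (ideal_of (set (take j us)) :: ('n, 'k) mpoly set)
      \<longleftrightarrow> (\<exists>w\<in>set (take j ts). w \<preceq> s)" for s
      by (simp add: take ideal_of_monomials up_closure_def)
    obtain Z where Z: "colon_ideal mpoly_ring (ideal_of (set (take j us))) (us ! j)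
             = ideal_of (variable ` Z)"
      using us(3)[of j] \<open>i < j\<close> ij(3) by (auto simp: us_eq)
    have colon: "monomial s \<in> ideal_of (variable ` Z :: ('n, 'k) mpoly set)
      \<longleftrightarrow> (\<exists>w\<in>set (take j ts). w \<preceq> s + v)" for s
    proof -
      have "monomial s \<in> ideal_of (variable ` Z :: ('n, 'k) mpoly set)
          \<longleftrightarrow> monomial s * us ! j \<in> ideal_of (set (take j us))"
        by (simp add: Z[symmetric] colon_ideal_def)
      also have "monomial s * us ! j = monomial (s + v)"
        using ij by (simp add: us_eq monomial_add)
      finally show ?thesis by (simp add: mem)
    qed
    have var: "variable ` Z = (monomial ` (unit_exp ` Z) :: ('n, 'k) mpoly set)"
      by (auto simp: variable_eq)
    \<comment> \<open>Subtraction is truncated: \<open>u - v\<close> is the exponent of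
      \<open>u / gcd(u, v)\<close>, and \<open>(u - v) + v\<close> that of the least common
      multiple.\<close>
    have "u \<preceq> (u - v) + v"
      unfolding exp_le_def lookup_add lookup_minus by (intro allI) linarith
    moreover have "u \<in> set (take j ts)"
      using \<open>i < j\<close> ij by (auto simp: in_set_conv_nth)
    ultimately have "monomial (u - v) \<in> ideal_of (variable ` Z :: ('n, 'k) mpoly set)"
      using colon by blast
    then obtain a where a: "a \<in> Z" "unit_exp a \<preceq> u - v"
      unfolding var ideal_of_monomials by (auto simp: up_closure_def)
    have "lookup v a < lookup u a"
      using a(2)[unfolded exp_le_def, rule_format, of a] by (simp add: lookup_minus lookup_unit_exp)
    moreover have "monomial (unit_exp a) \<in> ideal_of (variable ` Z :: ('n, 'k) mpoly set)"
      using a(1) subset_ideal_of[of "variable ` Z :: ('n, 'k) mpoly set"]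
        by (auto simp: variable_eq)
    then obtain w where w: "w \<in> set (take j ts)" "w \<preceq> unit_exp a + v"
      using colon by blast
    then obtain l where "l < j" "w = ts ! l" "l < length ts"
      by (auto simp: in_set_conv_nth)
    hence "r w < r v" "w \<in> min_exps E" using r ij ts(2) by auto
    ultimately show ?thesis using w(2) by (metis add.commute)
  qed
  moreover have "inj_on r (min_exps E)"
    unfolding ts(2)[symmetric] by (rule inj_onI) (metis in_set_conv_nth r)
  moreover have "finite (min_exps E)" unfolding ts(2)[symmetric] by simp
  moreover have "\<forall>u\<in>min_exps E. \<forall>v\<in>min_exps E. u \<preceq> v \<longrightarrow> u = v"
    by (auto simp: min_exps_def)
  ultimately have "lq_rank (min_exps E) r" unfolding lq_rank_def by blast
  thus thesis by (rule that)
qed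


section \<open>The Koszul complex\<close>

context
  fixes idx :: "'n::finite \<Rightarrow> nat" and x :: "'n \<Rightarrow> 'a::comm_ring_1"
  assumes inj_idx: "inj idx"
begin

text \<open>
  A Koszul chain is a function \<open>w\<close> on all sets of variables, \<open>w \<sigma>\<close> being the coefficient at the wedge
  of the \<open>e\<^sub>i\<close> with \<open>i \<in> \<sigma>\<close>, in increasing order of \<open>idx i\<close>; chains need not be homogeneous.
\<close>

definition koszul_sign :: "'n \<Rightarrow> 'n set \<Rightarrow> 'a"
  where "koszul_sign e \<sigma> = (-1) ^ card {p \<in> \<sigma>. idx p < idx e}"

definition koszul_d :: "('n set \<Rightarrow> 'a) \<Rightarrow> 'n set \<Rightarrow> 'a"
  where "koszul_d w \<sigma> = (\<Sum>e\<in>-\<sigma>. koszul_sign e \<sigma> * x e * w (insert e \<sigma>))"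

text \<open>Left exterior multiplication by the sum of the \<open>g_e e_e\<close>, which serves as a
  homotopy.\<close>

definition koszul_h :: "('n \<Rightarrow> 'a) \<Rightarrow> ('n set \<Rightarrow> 'a) \<Rightarrow> 'n set \<Rightarrow> 'a"
  where "koszul_h g w \<sigma> = (\<Sum>e\<in>\<sigma>. koszul_sign e \<sigma> * g e * w (\<sigma> - {e}))"

lemma koszul_sign_square [simp]: "koszul_sign e \<sigma> * koszul_sign e \<sigma> = 1"
  by (simp add: koszul_sign_def power_mult_distrib[symmetric])

lemma koszul_sign_insert:
  assumes "f \<notin> \<sigma>"
  shows "koszul_sign e (insert f \<sigma>)
    = (if idx f < idx e then - koszul_sign e \<sigma> else koszul_sign e \<sigma>)"
proof (cases "idx f < idx e")
  case True
  hence "{p \<in> insert f \<sigma>. idx p < idx e} = insert f {p \<in> \<sigma>. idx p < idx e}" by auto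
  thus ?thesis using True assms by (simp add: koszul_sign_def)
next
  case False
  hence "{p \<in> insert f \<sigma>. idx p < idx e} = {p \<in> \<sigma>. idx p < idx e}" by auto
  thus ?thesis using False by (simp add: koszul_sign_def)
qed

lemma koszul_sign_swap:
  assumes "e \<noteq> f" "e \<notin> \<sigma>" "f \<notin> \<sigma>"
  shows "koszul_sign e (insert f \<sigma>) * koszul_sign f \<sigma>
    = - (koszul_sign f (insert e \<sigma>) * koszul_sign e \<sigma>)"
proof -
  have "idx e \<noteq> idx f" using assms(1) inj_idx by (auto dest: injD)
  thus ?thesis using assms by (auto simp: koszul_sign_insert mult.commute)
qed

lemma koszul_d_add: "koszul_d (\<lambda>\<sigma>. v \<sigma> + w \<sigma>) \<sigma> = koszul_d v \<sigma> + koszul_d w \<sigma>"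
  by (simp add: koszul_d_def distrib_left sum.distrib)

lemma koszul_d_diff: "koszul_d (\<lambda>\<sigma>. v \<sigma> - w \<sigma>) \<sigma> = koszul_d v \<sigma> - koszul_d w \<sigma>"
  by (simp add: koszul_d_def right_diff_distrib sum_subtractf)

lemma koszul_d_mult: "koszul_d (\<lambda>\<sigma>. c * w \<sigma>) \<sigma> = c * koszul_d w \<sigma>"
  by (simp add: koszul_d_def sum_distrib_left mult_ac)

lemma koszul_d_ideal:
  assumes "is_ideal J" "\<And>\<sigma>. w \<sigma> \<in> J"
  shows "koszul_d w \<sigma> \<in> J"
  unfolding koszul_d_def using assms by (intro is_ideal_sum is_ideal_mult)

lemma koszul_h_ideal:
  assumes "is_ideal J" "\<And>\<sigma>. w \<sigma> \<in> J"
  shows "koszul_h g w \<sigma> \<in> J"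
  unfolding koszul_h_def using assms by (intro is_ideal_sum is_ideal_mult)

text \<open>The pairs with \<open>idx e < idx f\<close> cancel against their mirror images. Merely
  showing that the sum equals its own negative would not suffice in characteristic 2.\<close>

lemma sum_antisymmetric_eq_0:
  fixes A :: "'n \<Rightarrow> 'n \<Rightarrow> 'a"
  assumes "\<And>e f. e \<in> B \<Longrightarrow> f \<in> B \<Longrightarrow> e \<noteq> f \<Longrightarrow> A e f = - A f e"
  shows "(\<Sum>e\<in>B. \<Sum>f\<in>B - {e}. A e f) = 0"
proof -
  let ?P = "Sigma B (\<lambda>e. {f \<in> B. idx e < idx f})"
  let ?Q = "Sigma B (\<lambda>e. {f \<in> B. idx f < idx e})"
  have PQ: "Sigma B (\<lambda>e. B - {e}) = ?P \<union> ?Q" "?P \<inter> ?Q = {}"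
    using inj_idx by (auto dest: injD) (metis injD linorder_neqE_nat)
  have "(\<Sum>e\<in>B. \<Sum>f\<in>B - {e}. A e f) = (\<Sum>(e,f)\<in>?P \<union> ?Q. A e f)"
    unfolding PQ(1)[symmetric] by (simp add: sum.Sigma)
  also have "\<dots> = (\<Sum>(e,f)\<in>?P. A e f) + (\<Sum>(e,f)\<in>?Q. A e f)"
    using PQ(2) by (intro sum.union_disjoint) auto
  also have "(\<Sum>(e,f)\<in>?Q. A e f) = (\<Sum>(e,f)\<in>?P. A f e)"
    by (rule sum.reindex_bij_witness[of _ prod.swap prod.swap]) auto
  also have "\<dots> = (\<Sum>(e,f)\<in>?P. - A e f)"
    by (rule sum.cong) (auto intro!: assms)
  also have "\<dots> = - (\<Sum>(e,f)\<in>?P. A e f)"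
    by (simp add: sum_negf[symmetric] split_beta)
  finally show ?thesis by simp
qed

lemma koszul_d_d: "koszul_d (koszul_d w) \<sigma> = 0"
proof -
  let ?A = "\<lambda>e f. koszul_sign e \<sigma> * x e * (koszul_sign f (insert e \<sigma>) * x f * w (insert f (insert e \<sigma>)))"
  have "koszul_d (koszul_d w) \<sigma> = (\<Sum>e\<in>-\<sigma>. \<Sum>f\<in>- \<sigma> - {e}. ?A e f)"
    unfolding koszul_d_def by (intro sum.cong) (auto simp: sum_distrib_left intro!: sum.cong)
  also have "\<dots> = 0"
  proof (rule sum_antisymmetric_eq_0)
    fix e f assume ef: "e \<in> -\<sigma>" "f \<in> -\<sigma>" "e \<noteq> f"
    have "?A e f = (koszul_sign f (insert e \<sigma>) * koszul_sign e \<sigma>) * (x e * x f * w (insert e (insert f \<sigma>)))"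
      by (simp add: mult_ac insert_commute)
    also have "koszul_sign f (insert e \<sigma>) * koszul_sign e \<sigma>
      = - (koszul_sign e (insert f \<sigma>) * koszul_sign f \<sigma>)"
      using koszul_sign_swap[of f e \<sigma>] ef by simp
    also have "\<dots> * (x e * x f * w (insert e (insert f \<sigma>))) = - ?A f e"
      by (simp add: mult_ac)
    finally show "?A e f = - ?A f e" .
  qed
  finally show ?thesis .
qed

text \<open>Contraction with the \<open>x_e\<close> is an antiderivation \<open>d\<close>, and for
  \<open>h\<close> the sum of the \<open>g_e e_e\<close> it gives
  \<open>d(h w) + h d(w) = d(h) w\<close>. So every linear combination of the \<open>x_e\<close>
  annihilates Koszul homology.\<close>

lemma koszul_homotopy:
  "koszul_d (koszul_h g w) \<sigma> + koszul_h g (koszul_d w) \<sigma> = (\<Sum>e\<in>UNIV. g e * x e) * w \<sigma>"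
proof -
  have s_self: "koszul_sign e (insert e \<sigma>) = koszul_sign e \<sigma>" for e \<sigma>
    by (cases "e \<in> \<sigma>") (auto simp: insert_absorb koszul_sign_insert)
  have s_self': "koszul_sign e (\<sigma> - {e}) = koszul_sign e \<sigma>" for e \<sigma>
    using s_self[of e "\<sigma> - {e}"] s_self[of e \<sigma>] by (simp add: insert_Diff_single)
  have 1: "koszul_d (koszul_h g w) \<sigma> = (\<Sum>e\<in>-\<sigma>. g e * x e * w \<sigma>)
    + (\<Sum>e\<in>-\<sigma>. \<Sum>f\<in>\<sigma>. koszul_sign e \<sigma> * koszul_sign f (insert e \<sigma>) * (x e * g f * w (insert e (\<sigma> - {f}))))"
  proof -
    have "koszul_sign e \<sigma> * x e * koszul_h g w (insert e \<sigma>) = g e * x e * w \<sigma>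
      + (\<Sum>f\<in>\<sigma>. koszul_sign e \<sigma> * koszul_sign f (insert e \<sigma>) * (x e * g f * w (insert e (\<sigma> - {f}))))"
      if "e \<in> -\<sigma>" for e
    proof -
      have "koszul_h g w (insert e \<sigma>) = koszul_sign e \<sigma> * g e * w \<sigma>
        + (\<Sum>f\<in>\<sigma>. koszul_sign f (insert e \<sigma>) * g f * w (insert e \<sigma> - {f}))"
        using that by (simp add: koszul_h_def s_self)
      also have "(\<Sum>f\<in>\<sigma>. koszul_sign f (insert e \<sigma>) * g f * w (insert e \<sigma> - {f}))
        = (\<Sum>f\<in>\<sigma>. koszul_sign f (insert e \<sigma>) * g f * w (insert e (\<sigma> - {f})))"
        using that by (intro sum.cong refl arg_cong2[where f = "(*)"] arg_cong[where f = w]) auto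
      finally have h: "koszul_h g w (insert e \<sigma>) = koszul_sign e \<sigma> * g e * w \<sigma>
        + (\<Sum>f\<in>\<sigma>. koszul_sign f (insert e \<sigma>) * g f * w (insert e (\<sigma> - {f})))" .
      have "koszul_sign e \<sigma> * x e * koszul_h g w (insert e \<sigma>)
        = (koszul_sign e \<sigma> * koszul_sign e \<sigma>) * (g e * x e * w \<sigma>)
        + (\<Sum>f\<in>\<sigma>. koszul_sign e \<sigma> * koszul_sign f (insert e \<sigma>) * (x e * g f * w (insert e (\<sigma> - {f}))))"
        unfolding h distrib_left sum_distrib_left by (simp only: mult_ac)
      thus ?thesis by simp
    qed
    thus ?thesis unfolding koszul_d_def by (simp add: sum.distrib[symmetric])
  qed
  have 2: "koszul_h g (koszul_d w) \<sigma> = (\<Sum>f\<in>\<sigma>. g f * x f * w \<sigma>)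
    + (\<Sum>f\<in>\<sigma>. \<Sum>e\<in>-\<sigma>. koszul_sign f \<sigma> * koszul_sign e (\<sigma> - {f}) * (x e * g f * w (insert e (\<sigma> - {f}))))"
  proof -
    have "koszul_sign f \<sigma> * g f * koszul_d w (\<sigma> - {f}) = g f * x f * w \<sigma>
      + (\<Sum>e\<in>-\<sigma>. koszul_sign f \<sigma> * koszul_sign e (\<sigma> - {f}) * (x e * g f * w (insert e (\<sigma> - {f}))))"
      if "f \<in> \<sigma>" for f
    proof -
      have "- (\<sigma> - {f}) = insert f (- \<sigma>)" by auto
      hence d: "koszul_d w (\<sigma> - {f}) = koszul_sign f \<sigma> * x f * w \<sigma>
        + (\<Sum>e\<in>-\<sigma>. koszul_sign e (\<sigma> - {f}) * x e * w (insert e (\<sigma> - {f})))"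
        using that by (simp add: koszul_d_def s_self' insert_absorb)
      have "koszul_sign f \<sigma> * g f * koszul_d w (\<sigma> - {f})
        = (koszul_sign f \<sigma> * koszul_sign f \<sigma>) * (g f * x f * w \<sigma>)
        + (\<Sum>e\<in>-\<sigma>. koszul_sign f \<sigma> * koszul_sign e (\<sigma> - {f}) * (x e * g f * w (insert e (\<sigma> - {f}))))"
        unfolding d distrib_left sum_distrib_left by (simp only: mult_ac)
      thus ?thesis by simp
    qed
    thus ?thesis unfolding koszul_h_def by (simp add: sum.distrib[symmetric])
  qed
  \<comment> \<open>Adding \<open>e\<close> and removing \<open>f\<close> in the two possible orders
    gives opposite signs, so the mixed sums in \<open>1\<close> and \<open>2\<close> cancel and only
    the diagonal terms are left.\<close>
  have "koszul_sign e \<sigma> * koszul_sign f (insert e \<sigma>)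
    = - (koszul_sign f \<sigma> * koszul_sign e (\<sigma> - {f}))"
    if "e \<in> -\<sigma>" "f \<in> \<sigma>" for e f
  proof -
    have "koszul_sign e (insert f (\<sigma> - {f})) * koszul_sign f (\<sigma> - {f})
        = - (koszul_sign f (insert e (\<sigma> - {f})) * koszul_sign e (\<sigma> - {f}))"
      by (rule koszul_sign_swap) (use that in auto)
    moreover have "insert f (\<sigma> - {f}) = \<sigma>" using that by auto
    moreover have "koszul_sign f (insert e (\<sigma> - {f})) = koszul_sign f (insert e \<sigma>)"
      using s_self'[of f "insert e \<sigma>"] s_self'[of f "insert e (\<sigma> - {f})"] that
      by (metis Diff_idemp insert_Diff_if insert_iff singletonD ComplD)
    ultimately have *: "koszul_sign e \<sigma> * koszul_sign f \<sigma>
        = - (koszul_sign f (insert e \<sigma>) * koszul_sign e (\<sigma> - {f}))"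
      by (simp add: s_self')
    have "koszul_sign e \<sigma> * koszul_sign f (insert e \<sigma>)
      = (koszul_sign e \<sigma> * koszul_sign f \<sigma>) * (koszul_sign f \<sigma> * koszul_sign f (insert e \<sigma>))"
      using koszul_sign_square[of f \<sigma>] by (metis mult.assoc mult.left_neutral mult.commute)
    also have "\<dots> = - (koszul_sign f \<sigma> * koszul_sign e (\<sigma> - {f}))
        * (koszul_sign f (insert e \<sigma>) * koszul_sign f (insert e \<sigma>))"
      unfolding * by (simp only: minus_mult_left[symmetric] minus_mult_right[symmetric] mult_ac)
    finally show ?thesis by simp
  qed
  hence "(\<Sum>e\<in>-\<sigma>. \<Sum>f\<in>\<sigma>. koszul_sign e \<sigma> * koszul_sign f (insert e \<sigma>) * (x e * g f * w (insert e (\<sigma> - {f}))))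
    = (\<Sum>e\<in>-\<sigma>. \<Sum>f\<in>\<sigma>. - (koszul_sign f \<sigma> * koszul_sign e (\<sigma> - {f}) * (x e * g f * w (insert e (\<sigma> - {f})))))"
    by (intro sum.cong refl) simp
  also have "\<dots> = - (\<Sum>f\<in>\<sigma>. \<Sum>e\<in>-\<sigma>. koszul_sign f \<sigma> * koszul_sign e (\<sigma> - {f}) * (x e * g f * w (insert e (\<sigma> - {f}))))"
    by (subst sum.swap) (simp add: sum_negf)
  finally have "koszul_d (koszul_h g w) \<sigma> + koszul_h g (koszul_d w) \<sigma>
    = (\<Sum>e\<in>-\<sigma>. g e * x e * w \<sigma>) + (\<Sum>f\<in>\<sigma>. g f * x f * w \<sigma>)"
    unfolding 1 2 by simp
  also have "\<dots> = (\<Sum>e\<in>UNIV. g e * x e * w \<sigma>)"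
    by (subst sum.union_disjoint[symmetric]) auto
  finally show ?thesis by (simp add: sum_distrib_right)
qed

text \<open>
  Descending induction on \<open>k\<close>: as \<open>fs k\<close> annihilates the Koszul homology, \<open>fs k * w\<close> is the boundary of
  a chain \<open>t\<close> modulo \<open>N k\<close>. This \<open>t\<close> is a cycle modulo \<open>N (k + 1)\<close>, hence a boundary there, and cancelling
  \<open>fs k\<close> shows that \<open>w\<close> is a boundary modulo \<open>N k\<close>.
\<close>

lemma koszul_vanishing:
  fixes N :: "nat \<Rightarrow> 'a set" and w :: "'n set \<Rightarrow> 'a"
  assumes ideal: "\<And>k. k \<le> r \<Longrightarrow> is_ideal (N k)"
    and max: "\<And>k. k < r \<Longrightarrow> \<exists>g. fs k = (\<Sum>e\<in>UNIV. g e * x e)"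
    and mono: "\<And>k. k < r \<Longrightarrow> N k \<subseteq> N (Suc k)"
    and mem: "\<And>k. k < r \<Longrightarrow> fs k \<in> N (Suc k)"
    and gen: "\<And>k a. k < r \<Longrightarrow> a \<in> N (Suc k) \<Longrightarrow> \<exists>b c. b \<in> N k \<and> a = b + c * fs k"
    and regular: "\<And>k a. k < r \<Longrightarrow> fs k * a \<in> N k \<Longrightarrow> a \<in> N k"
    and w: "k \<le> r" "\<And>\<sigma>. card \<sigma> + r \<le> CARD('n) + k \<Longrightarrow> w \<sigma> = 0" "\<And>\<sigma>. koszul_d w \<sigma> \<in> N k"
  shows "\<exists>v. \<forall>\<sigma>. w \<sigma> - koszul_d v \<sigma> \<in> N k"
  using w
proof (induction k arbitrary: w rule: inc_induct)
  case base
  \<comment> \<open>For \<open>k = r\<close> the support condition reaches every set, as none has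
    more than \<open>n\<close> elements.\<close>
  have "w \<sigma> = 0" for \<sigma>
    by (rule base) (simp add: card_mono)
  thus ?case using is_ideal_0[OF ideal[of r]]
    by (intro exI[of _ "\<lambda>_. 0"]) (simp add: koszul_d_def)
next
  case (step k)
  obtain g where g: "fs k = (\<Sum>e\<in>UNIV. g e * x e)" using max step.hyps by blast
  define t where "t = koszul_h g w"
  have dt: "koszul_d t \<sigma> = fs k * w \<sigma> - koszul_h g (koszul_d w) \<sigma>" for \<sigma>
    using koszul_homotopy[of g w \<sigma>] unfolding t_def g by (simp add: algebra_simps)
  have Nk: "is_ideal (N k)" and NSk: "is_ideal (N (Suc k))" using ideal step.hyps by auto
  have hd: "koszul_h g (koszul_d w) \<sigma> \<in> N k" for \<sigma>
    using koszul_h_ideal[OF Nk] step.prems by blast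
  have "\<exists>v. \<forall>\<sigma>. t \<sigma> - koszul_d v \<sigma> \<in> N (Suc k)"
  proof (rule step.IH)
    fix \<sigma> :: "'n set" assume card: "card \<sigma> + r \<le> CARD('n) + Suc k"
    have "w (\<sigma> - {e}) = 0" if "e \<in> \<sigma>" for e
      using card that card_gt_0_iff[of \<sigma>] by (intro step.prems) (auto simp: card_Diff_singleton)
    thus "t \<sigma> = 0" by (simp add: t_def koszul_h_def)
  next
    fix \<sigma>
    have "fs k \<in> N (Suc k)" using mem step.hyps by blast
    hence "fs k * w \<sigma> \<in> N (Suc k)"
      using is_ideal_mult[OF NSk, of "fs k" "w \<sigma>"] by (simp add: mult.commute)
    moreover have "koszul_h g (koszul_d w) \<sigma> \<in> N (Suc k)" using hd mono step.hyps by blast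
    ultimately show "koszul_d t \<sigma> \<in> N (Suc k)" unfolding dt by (rule is_ideal_diff[OF NSk])
  qed
  then obtain v where "\<And>\<sigma>. t \<sigma> - koszul_d v \<sigma> \<in> N (Suc k)" by blast
  hence "\<exists>b c. b \<in> N k \<and> t \<sigma> - koszul_d v \<sigma> = b + c * fs k" for \<sigma>
    using gen step.hyps by blast
  then obtain b c where bc: "\<And>\<sigma>. b \<sigma> \<in> N k" "\<And>\<sigma>. t \<sigma> - koszul_d v \<sigma> = b \<sigma> + c \<sigma> * fs k"
    by metis
  have t: "t = (\<lambda>\<sigma>. koszul_d v \<sigma> + (b \<sigma> + fs k * c \<sigma>))"
    using bc(2) by (auto simp: fun_eq_iff algebra_simps)
  \<comment> \<open>The boundary of \<open>v\<close> is itself a cycle and drops out; comparison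
    with \<open>dt\<close> leaves a multiple of \<open>fs k\<close> inside \<open>N k\<close>, ready
    for cancellation.\<close>
  have "koszul_d t \<sigma> = koszul_d b \<sigma> + fs k * koszul_d c \<sigma>" for \<sigma>
    unfolding t koszul_d_add koszul_d_d koszul_d_mult by simp
  hence "fs k * (w \<sigma> - koszul_d c \<sigma>) = koszul_d b \<sigma> + koszul_h g (koszul_d w) \<sigma>" for \<sigma>
    using dt[of \<sigma>] by (simp add: algebra_simps)
  moreover have "koszul_d b \<sigma> + koszul_h g (koszul_d w) \<sigma> \<in> N k" for \<sigma>
    using koszul_d_ideal[OF Nk bc(1)] hd by (rule is_ideal_add[OF Nk])
  ultimately have "w \<sigma> - koszul_d c \<sigma> \<in> N k" for \<sigma>
    using regular[of k] step.hyps by simp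
  thus ?case by blast
qed

end


section \<open>Colon ideals with two generators\<close>

text \<open>
  The sets \<open>{p. lookup k p < lookup b p}\<close>, for the earlier generators \<open>k\<close> dividing \<open>b\<close>, generate
  the upper Koszul complex of \<open>b\<close>; the lemma says that this complex is connected.
\<close>

lemma connected_supports:
  fixes b :: "'n::finite \<Rightarrow>\<^sub>0 nat"
  assumes lq: "lq_rank G r"
    and deg: "\<And>k. k \<in> G \<Longrightarrow> r k < n \<Longrightarrow> total_deg k + 2 \<le> total_deg b"
    and Q: "\<And>k p q. k \<in> G \<Longrightarrow> r k < n \<Longrightarrow> k \<preceq> b \<Longrightarrow> lookup k p < lookup b p \<Longrightarrow>
      lookup k q < lookup b q \<Longrightarrow> Q p \<Longrightarrow> Q q"
    and k: "k \<in> G" "r k < n" "k \<preceq> b" and l: "l \<in> G" "r l < n" "l \<preceq> b"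
    and p: "lookup k p < lookup b p" "Q p"
    and q: "lookup l q < lookup b q"
  shows "Q q"
proof -
  \<comment> \<open>As \<open>Q\<close> spreads within each support, it holds on all of a support or
    nowhere on it. Generators whose supports meet therefore agree about \<open>A\<close>.\<close>
  define A where "A k \<longleftrightarrow> (\<forall>p. lookup k p < lookup b p \<longrightarrow> Q p)" for k
  have meet: "A k \<longleftrightarrow> A s"
    if "k \<in> G" "r k < n" "k \<preceq> b" "s \<in> G" "r s < n" "s \<preceq> b"
      "lookup k p < lookup b p" "lookup s p < lookup b p" for k s p
    unfolding A_def using Q[of k p] Q[of s p] that by blast
  have "A k \<longleftrightarrow> A l" if "k \<in> G" "r k < n" "k \<preceq> b" "l \<in> G" "r l < n" "l \<preceq> b"
      "r k < N" "r l < N" for k l N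
    using that
  proof (induction N arbitrary: k l)
    case (Suc N)
    have earlier: "A k \<longleftrightarrow> A l" if kl: "k \<in> G" "r k < n" "k \<preceq> b" "l \<in> G" "r l < n" "l \<preceq> b"
        "r k < Suc N" "r l < r k" for k l
    proof -
      obtain s a where s: "s \<in> G" "r s < r k" "s \<preceq> k + unit_exp a" "lookup k a < lookup l a"
        using lq_rankD[OF lq \<open>l \<in> G\<close> \<open>k \<in> G\<close> \<open>r l < r k\<close>] by blast
      have s_le: "lookup s i \<le> lookup k i + (if i = a then 1 else 0)" for i
        using s(3)[unfolded exp_le_def, rule_format, of i] by (simp add: lookup_add lookup_unit_exp)
      have "lookup s i \<le> lookup b i" for i
        using s_le[of i] s(4) kl(3,6)[unfolded exp_le_def, rule_format, of i]
        by (cases "i = a") auto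
      hence sb: "s \<preceq> b" by (simp add: exp_le_def)
      \<comment> \<open>The gap of two degrees is used here: at some variable even
        \<open>k x_a\<close> is strictly below \<open>b\<close>, hence so are both \<open>k\<close>
        and \<open>s\<close>, and their supports meet.\<close>
      have "\<not> b \<preceq> k + unit_exp a"
        using deg[of k] kl total_deg_mono[of b "k + unit_exp a"] by auto
      then obtain i where "lookup k i + (if i = a then 1 else 0) < lookup b i"
        by (auto simp: exp_le_def not_le lookup_add lookup_unit_exp)
      hence "lookup k i < lookup b i" "lookup s i < lookup b i"
        using s_le[of i] by auto
      hence "A k \<longleftrightarrow> A s" using meet[of k s i] kl s sb by simp
      moreover have "A s \<longleftrightarrow> A l" using Suc.IH[of s l] kl s sb by simp
      ultimately show ?thesis by simp
    qed
    consider "r k < r l" | "r l < r k" | "r k = r l" by linarith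
    thus ?case
    proof cases
      case 1
      thus ?thesis using earlier[of l k] Suc.prems by simp
    next
      case 2
      thus ?thesis using earlier[of k l] Suc.prems by simp
    next
      case 3
      hence "k = l" using lq Suc.prems by (auto simp: lq_rank_def dest: inj_onD)
      thus ?thesis by simp
    qed
  qed simp
  from this[of k l n] have "A k \<longleftrightarrow> A l" using k l by simp
  moreover have "A k" unfolding A_def using Q[of k p] k p by blast
  ultimately show ?thesis using q unfolding A_def by blast
qed

lemma koszul_d_face:
  fixes idx :: "'n::finite \<Rightarrow> nat" and x :: "'n \<Rightarrow> 'a::comm_ring_1"
  assumes "inj idx" "e \<in> \<tau>" 
  shows "koszul_d idx x (\<lambda>\<sigma>. if \<sigma> = \<tau> then m else 0) (\<tau> - {e})
    = koszul_sign idx e (\<tau> - {e}) * x e * m"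
proof -
  have "koszul_d idx x (\<lambda>\<sigma>. if \<sigma> = \<tau> then m else 0) (\<tau> - {e})
    = (\<Sum>f\<in>-(\<tau> - {e}). if f = e then koszul_sign idx e (\<tau> - {e}) * x e * m else 0)"
    unfolding koszul_d_def[OF assms(1)] using assms(2) by (intro sum.cong) auto
  thus ?thesis by (simp add: sum.delta)
qed

lemma koszul_d_not_face:
  fixes idx :: "'n::finite \<Rightarrow> nat" and x :: "'n \<Rightarrow> 'a::comm_ring_1"
  assumes "inj idx" "\<And>e. e \<in> \<tau> \<Longrightarrow> \<sigma> \<noteq> \<tau> - {e}" 
  shows "koszul_d idx x (\<lambda>\<sigma>. if \<sigma> = \<tau> then m else 0) \<sigma> = 0"
proof -
  have "insert e \<sigma> \<noteq> \<tau>" if "e \<in> -\<sigma>" for e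
  proof
    assume "insert e \<sigma> = \<tau>"
    hence "\<sigma> = \<tau> - {e}" "e \<in> \<tau>" using that by auto
    thus False using assms(2) by blast
  qed
  thus ?thesis unfolding koszul_d_def[OF assms(1)] by (intro sum.neutral) auto
qed

lemma koszul_sign_cases:
  assumes "inj (idx :: 'n::finite \<Rightarrow> nat)"
  shows "koszul_sign idx e \<sigma> = 1 \<or> koszul_sign idx e \<sigma> = (- 1 :: 'a::comm_ring_1)"
  unfolding koszul_sign_def[OF assms] by (simp add: minus_one_power_iff)

text \<open>In the upper Koszul complex of \<open>b = v x_a x_c\<close> the edge
  \<open>{a, c}\<close> comes from \<open>v\<close> and lies in no triangle, because
  \<open>v\<close> is a minimal generator. Earlier generators join \<open>a\<close> to
  \<open>c\<close> by other edges. The resulting circle does not bound; filling it by triangles over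
  \<open>S\<close> gives the cycle of degree 3 that contradicts \<open>vanishing\<close>.\<close>

lemma colon_vars_unique:
  fixes idx :: "'n::finite \<Rightarrow> nat"
  assumes idx: "inj idx" and lq: "lq_rank G r"
    and sorted: "\<And>u v. u \<in> G \<Longrightarrow> v \<in> G \<Longrightarrow> r u < r v \<Longrightarrow> total_deg u \<le> total_deg v"
    and vanishing: "\<And>w. (\<And>\<sigma>. card \<sigma> \<le> 2 \<Longrightarrow> w \<sigma> = 0) \<Longrightarrow>
      (\<And>\<sigma>. koszul_d idx variable w \<sigma> \<in> (supp_ideal (up_closure G) :: ('n, 'k::field) mpoly set)) \<Longrightarrow>
      \<exists>y. \<forall>\<sigma>. w \<sigma> - koszul_d idx variable y \<sigma> \<in> supp_ideal (up_closure G)"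
    and v: "v \<in> G" and a: "a \<in> colon_vars G r v" and c: "c \<in> colon_vars G r v"
  shows "a = c"
proof (rule ccontr)
  assume ac: "a \<noteq> c"
  let ?d = "koszul_d idx (variable :: 'n \<Rightarrow> ('n, 'k) mpoly)"
  let ?s = "koszul_sign idx :: 'n \<Rightarrow> 'n set \<Rightarrow> ('n, 'k) mpoly"
  define b where "b = v + unit_exp a + unit_exp c"
  have b: "lookup b i = lookup v i + (if i = a \<or> i = c then 1 else 0)" for i
    using ac by (simp add: b_def lookup_add lookup_unit_exp)
  \<comment> \<open>Only the earlier generators enter, not all of \<open>I\<close>: \<open>v\<close>
    lies outside this ideal, so the coefficient of \<open>v\<close> is determined by a congruence
    modulo \<open>J\<close>.\<close>
  define J :: "('n, 'k) mpoly set" where "J = supp_ideal (up_closure {g \<in> G. r g < r v})"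
  have J: "is_ideal J" unfolding J_def by (intro is_ideal_supp_ideal) simp
  \<comment> \<open>\<open>Q p\<close>: modulo \<open>J\<close>, the edge \<open>{a, p}\<close> of multidegree \<open>b\<close> is a boundary. This property is passed on
    along the edges \<open>{p, q}\<close> with coefficient in \<open>J\<close>, by means of the triangle \<open>{a, p, q}\<close>.\<close>
  define Q where "Q p \<longleftrightarrow> p = a \<or> (\<exists>w. (\<forall>\<sigma>. card \<sigma> \<le> 2 \<longrightarrow> w \<sigma> = 0) \<and>
     (\<forall>\<sigma>. ?d w \<sigma> - (if \<sigma> = {a, p} then monomial (b - unit_exp a - unit_exp p) else 0) \<in> J))" for p
  have edge: "monomial (b - unit_exp p - unit_exp q) \<in> J"
    if "k \<in> G" "r k < r v" "k \<preceq> b" "lookup k p < lookup b p"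
      "lookup k q < lookup b q" "p \<noteq> q" for k p q
  proof -
    have "lookup k i \<le> lookup (b - unit_exp p - unit_exp q) i" for i
      using that(3)[unfolded exp_le_def, rule_format, of i] that(4,5,6)
      by (auto simp: lookup_minus lookup_unit_exp)
    hence "k \<preceq> b - unit_exp p - unit_exp q" by (simp add: exp_le_def)
    thus ?thesis using that(1,2) by (auto simp: J_def up_closure_def)
  qed
  have Q_step: "Q q" if k: "k \<in> G" "r k < r v" "k \<preceq> b"
    and p: "lookup k p < lookup b p"
    and q: "lookup k q < lookup b q" and Qp: "Q p" for k p q
  proof -
    consider "q = a \<or> q = p" | "q \<noteq> a" "p = a" | "q \<noteq> a" "p \<noteq> a" "q \<noteq> p" by blast
    thus ?thesis
    proof cases
      case 1
        moreover have "Q a" by (simp add: Q_def)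
        ultimately show ?thesis using Qp by auto
    next
      case 2
      have "monomial (b - unit_exp a - unit_exp q) \<in> J"
        using edge[of k a q] k p q 2 by auto
      hence "?d (\<lambda>_. 0) \<sigma> - (if \<sigma> = {a, q} then monomial (b - unit_exp a - unit_exp q) else 0) \<in> J"
        for \<sigma>
        using is_ideal_0[OF J] is_ideal_uminus[OF J] by (simp add: koszul_d_def[OF idx])
      thus ?thesis unfolding Q_def by (intro disjI2 exI[of _ "\<lambda>_. 0"]) simp
    next
      case 3
      let ?\<tau> = "{a, p, q}"
      define t where "t = b - unit_exp a - unit_exp p - unit_exp q"
      define w1 where "w1 = (\<lambda>\<sigma>. if \<sigma> = ?\<tau> then monomial t :: ('n, 'k) mpoly else 0)"
      \<comment> \<open>The subtractions lose nothing: \<open>p\<close> and \<open>q\<close> are in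
        the support of \<open>k\<close>, so \<open>b\<close> is positive there, and \<open>b\<close>
        exceeds \<open>v\<close> at \<open>a\<close>.\<close>
      have t: "t + unit_exp a = b - unit_exp p - unit_exp q"
        "t + unit_exp p = b - unit_exp a - unit_exp q"
        "t + unit_exp q = b - unit_exp a - unit_exp p"
        using p q 3 b[of a]
        by (auto intro!: poly_mapping_eqI simp: t_def lookup_add lookup_minus lookup_unit_exp)
      have m: "variable i * monomial t = (monomial (t + unit_exp i) :: ('n, 'k) mpoly)" for i
        by (simp add: variable_eq monomial_add mult.commute)
      obtain w where w: "\<And>\<sigma>. card \<sigma> \<le> 2 \<Longrightarrow> w \<sigma> = 0"
        "\<And>\<sigma>. ?d w \<sigma> - (if \<sigma> = {a, p} then monomial (b - unit_exp a - unit_exp p) else 0) \<in> J"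
        using Qp 3 unfolding Q_def by blast
      define s1 where "s1 = ?s p {a, q}"
      define s2 where "s2 = ?s q {a, p}"
      define s3 where "s3 = ?s a {p, q}"
      have s1s1: "s1 * s1 = 1" unfolding s1_def by (rule koszul_sign_square[OF idx])
      define m1 m2 m3 :: "('n, 'k) mpoly" where "m1 = monomial (b - unit_exp a - unit_exp q)"
        and "m2 = monomial (b - unit_exp a - unit_exp p)"
        and "m3 = monomial (b - unit_exp p - unit_exp q)"
      have d1: "?d w1 \<sigma> = (if \<sigma> = {a, q} then s1 * m1 else 0) + (if \<sigma> = {a, p} then s2 * m2 else 0)
          + (if \<sigma> = {p, q} then s3 * m3 else 0)" for \<sigma>
      proof -
        have face: "?d w1 (?\<tau> - {e}) = ?s e (?\<tau> - {e}) * monomial (t + unit_exp e)" if "e \<in> ?\<tau>"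
          for e
          unfolding w1_def koszul_d_face[OF idx that] by (simp add: m mult.assoc)
        have \<tau>: "?\<tau> - {a} = {p, q}" "?\<tau> - {p} = {a, q}" "?\<tau> - {q} = {a, p}" using 3 by auto
        consider "\<sigma> = {a, q}" | "\<sigma> = {a, p}" | "\<sigma> = {p, q}"
          | "\<sigma> \<noteq> {a, q}" "\<sigma> \<noteq> {a, p}" "\<sigma> \<noteq> {p, q}" by blast
        thus ?thesis
        proof cases
          case 1
          have "\<sigma> \<noteq> {a, p}" "\<sigma> \<noteq> {p, q}" using 1 3 by auto
          thus ?thesis using face[of p] unfolding \<tau> t by (simp add: 1 s1_def m1_def)
        next
          case 2
          have "\<sigma> \<noteq> {a, q}" "\<sigma> \<noteq> {p, q}" using 2 3 by auto
          thus ?thesis using face[of q] unfolding \<tau> t by (simp add: 2 s2_def m2_def)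
        next
          case c3: 3
          have "\<sigma> \<noteq> {a, q}" "\<sigma> \<noteq> {a, p}" using c3 3 by auto
          thus ?thesis using face[of a] unfolding \<tau> t by (simp add: c3 s3_def m3_def)
        next
          case 4
          have "\<sigma> \<noteq> ?\<tau> - {e}" if "e \<in> ?\<tau>" for e using that \<tau> 4 by auto
          hence "?d w1 \<sigma> = 0" unfolding w1_def by (rule koszul_d_not_face[OF idx])
          thus ?thesis using 4 by simp
        qed
      qed
      \<comment> \<open>The boundary of the triangle has the edges \<open>{a, q}\<close>,
        \<open>{a, p}\<close> and \<open>{p, q}\<close>. Subtracting \<open>s2 * w\<close> removes
        the second modulo \<open>J\<close>, the third has its coefficient in \<open>J\<close>, and
        the factor \<open>s1\<close> turns the sign at the first into 1.\<close>
      define w2 where "w2 = (\<lambda>\<sigma>. s1 * (w1 \<sigma> - s2 * w \<sigma>))"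
      have "?d w2 \<sigma> - (if \<sigma> = {a, q} then m1 else 0) \<in> J" for \<sigma>
      proof -
        have "?d w2 \<sigma> = s1 * (?d w1 \<sigma> - s2 * ?d w \<sigma>)"
          unfolding w2_def by (simp add: koszul_d_mult[OF idx] koszul_d_diff[OF idx])
        also have "\<dots> = (if \<sigma> = {a, q} then m1 else 0)
           + ((s1 * (if \<sigma> = {p, q} then s3 else 0)) * m3 - (s1 * s2) * (?d w \<sigma> - (if \<sigma>
             = {a, p} then m2 else 0)))"
          unfolding d1 using s1s1
          by (simp add: algebra_simps)
        finally have eq: "?d w2 \<sigma> - (if \<sigma> = {a, q} then m1 else 0)
           = (s1 * (if \<sigma> = {p, q} then s3 else 0)) * m3 - (s1 * s2) * (?d w \<sigma> - (if \<sigma>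
             = {a, p} then m2 else 0))"
          by simp
        have "m3 \<in> J" unfolding m3_def by (rule edge[OF k p q]) (use 3 in auto)
        show ?thesis unfolding eq
          by (rule is_ideal_diff[OF J is_ideal_mult[OF J \<open>m3
            \<in> J\<close>] is_ideal_mult[OF J w(2)[folded m2_def]]])
      qed
      moreover have "w2 \<sigma> = 0" if "card \<sigma> \<le> 2" for \<sigma>
      proof -
        have "card ?\<tau> = 3" using 3 by simp
        hence "\<sigma> \<noteq> ?\<tau>" using that by auto
        thus ?thesis using w(1)[OF that] by (simp add: w2_def w1_def)
      qed
      ultimately show ?thesis unfolding Q_def m1_def by blast
    qed
  qed
  have deg: "total_deg k + 2 \<le> total_deg b" if "k \<in> G" "r k < r v" for k
    using sorted[OF that(1) v that(2)] by (simp add: b_def)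
  \<comment> \<open>The choice is crosswise: \<open>k\<close> divides \<open>v x_c\<close> and is
    therefore below \<open>b\<close> at \<open>a\<close>, while \<open>l\<close> divides
    \<open>v x_a\<close> and is below \<open>b\<close> at \<open>c\<close>.\<close>
  obtain k where k: "k \<in> G" "r k < r v" "k \<preceq> v + unit_exp c"
    using c by (auto simp: colon_vars_def)
  obtain l where l: "l \<in> G" "r l < r v" "l \<preceq> v + unit_exp a"
    using a by (auto simp: colon_vars_def)
  have kb: "k \<preceq> b" using exp_le_trans[OF k(3), of b] by (simp add: exp_le_def b_def lookup_add)
  have lb: "l \<preceq> b" using exp_le_trans[OF l(3), of b] by (simp add: exp_le_def b_def lookup_add)
  have ka: "lookup k a < lookup b a"
    using k(3)[unfolded exp_le_def, rule_format, of a] ac b[of a]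
      by (simp add: lookup_add lookup_unit_exp)
  have lc: "lookup l c < lookup b c"
    using l(3)[unfolded exp_le_def, rule_format, of c] ac b[of c]
      by (simp add: lookup_add lookup_unit_exp)
  have "Q a" by (simp add: Q_def)
  have "Q c"
    by (rule connected_supports[where Q = Q
      and n = "r v", OF lq deg Q_step k(1,2) kb l(1,2) lb ka \<open>Q a\<close> lc])
  have bv: "b - unit_exp a - unit_exp c = v"
    by (rule poly_mapping_eqI) (use ac in \<open>auto simp: b lookup_minus lookup_unit_exp\<close>)
  obtain w where w: "\<And>\<sigma>. card \<sigma> \<le> 2 \<Longrightarrow> w \<sigma> = 0"
    "\<And>\<sigma>. ?d w \<sigma> - (if \<sigma> = {a, c} then monomial v else 0) \<in> J"
    using \<open>Q c\<close> ac unfolding Q_def bv by blast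
  let ?I = "supp_ideal (up_closure G) :: ('n, 'k) mpoly set"
  have I: "is_ideal ?I" by (intro is_ideal_supp_ideal) simp
  have JI: "J \<subseteq> ?I" unfolding J_def by (intro supp_ideal_mono up_closure_mono) auto
  have "?d w \<sigma> \<in> ?I" for \<sigma>
  proof -
    have "monomial v \<in> ?I" using v subset_up_closure by auto
    hence "(if \<sigma> = {a, c} then monomial v else 0) \<in> ?I" using is_ideal_0[OF I] by simp
    from is_ideal_add[OF I subsetD[OF JI w(2)[of \<sigma>]] this] show ?thesis by simp
  qed
  \<comment> \<open>The cycle \<open>w\<close> is not a boundary: as \<open>v\<close> is a minimal generator, the coefficient of \<open>v\<close> at the edge
    \<open>{a, c}\<close> of the boundary of a chain over \<open>I\<close> is zero.\<close>
  with vanishing[of w] w(1) obtain y where y: "\<And>\<sigma>. w \<sigma> - ?d y \<sigma> \<in> ?I" by blast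
  define z where "z = (\<lambda>\<sigma>. w \<sigma> - ?d y \<sigma>)"
  have "?d z \<sigma> = ?d w \<sigma>" for \<sigma>
    unfolding z_def koszul_d_diff[OF idx] koszul_d_d[OF idx] by simp
  hence "?d z {a, c} - monomial v \<in> J" using w(2)[of "{a, c}"] by simp
  moreover have "v \<notin> up_closure {g \<in> G. r g < r v}"
    using lq_rank_antichain[OF lq _ v] by (auto simp: up_closure_def)
  ultimately have "lookup (?d z {a, c} - monomial v) v = 0"
    by (auto simp: J_def supp_ideal_def in_keys_iff)
  hence one: "lookup (?d z {a, c}) v = 1"
    by (simp add: lookup_minus lookup_monomial)
  have "lookup (?s e {a, c} * variable e * z (insert e {a, c})) v = 0" for e
  proof -
    have "lookup (variable e * z (insert e {a, c})) v = 0"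
    proof (cases "unit_exp e \<preceq> v")
      case True
      have "v - unit_exp e \<notin> up_closure G"
      proof
        assume "v - unit_exp e \<in> up_closure G"
        then obtain g where g: "g \<in> G" "g \<preceq> v - unit_exp e" by (auto simp: up_closure_def)
        have ve: "unit_exp e + (v - unit_exp e) = v" using True by (rule exp_le_diff)
        hence "v - unit_exp e \<preceq> v" by (metis exp_le_add(2))
        with g have "g = v" using lq_rank_antichain[OF lq _ v] exp_le_trans by blast
        hence "total_deg v \<le> total_deg (v - unit_exp e)" using g(2) by (simp add: total_deg_mono)
        moreover have "total_deg v = Suc (total_deg (v - unit_exp e))"
          using arg_cong[OF ve, of total_deg] by simp
        ultimately show False by simp
      qed
      hence "lookup (z (insert e {a, c})) (v - unit_exp e) = 0"
        using y[of "insert e {a, c}"] by (auto simp: z_def supp_ideal_def in_keys_iff)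
      thus ?thesis by (simp add: variable_eq lookup_monomial_times)
    qed (simp add: variable_eq lookup_monomial_times)
    moreover have "?s e {a, c} = 1 \<or> ?s e {a, c} = -1" by (rule koszul_sign_cases[OF idx])
    ultimately show ?thesis by (auto simp: mult.assoc)
  qed
  hence "lookup (?d z {a, c}) v = 0"
    unfolding koszul_d_def[OF idx] lookup_sum by simp
  thus False using one by simp
qed

section \<open>Regular sequences in the maximal ideal and vanishing of Koszul homology\<close>

lemma max_ideal_sum:
  assumes "f \<in> (max_ideal :: ('n::finite, 'k::field) mpoly set)"
  shows "\<exists>g. f = (\<Sum>e\<in>UNIV. g e * variable e)"
proof -
  let ?K = "range (\<lambda>g. \<Sum>e\<in>UNIV. g e * (variable e :: ('n, 'k) mpoly))"
  have K_I: "(\<Sum>e\<in>UNIV. g e * variable e) \<in> ?K" for g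
    by (rule rangeI)
  have "is_ideal ?K"
  proof (rule is_idealI)
    show "0 \<in> ?K" by (rule range_eqI[of _ _ "\<lambda>_. 0"]) simp
    show "x + y \<in> ?K" if xy: "x \<in> ?K" "y \<in> ?K" for x y
    proof -
      obtain g h where "x = (\<Sum>e\<in>UNIV. g e * variable e)" "y = (\<Sum>e\<in>UNIV. h e * variable e)"
        using xy by auto
      hence eq: "x + y = (\<Sum>e\<in>UNIV. (g e + h e) * variable e)"
        by (simp add: sum.distrib distrib_right)
      show ?thesis unfolding eq by (rule K_I)
    qed
    show "r * x \<in> ?K" if x: "x \<in> ?K" for r x
    proof -
      obtain g where "x = (\<Sum>e\<in>UNIV. g e * variable e)" using x by auto
      hence eq: "r * x = (\<Sum>e\<in>UNIV. (r * g e) * variable e)"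
        by (simp add: sum_distrib_left mult.assoc)
      show ?thesis unfolding eq by (rule K_I)
    qed
  qed
  moreover have "range variable \<subseteq> ?K"
  proof clarify
    fix i
    have "(\<Sum>e\<in>UNIV. (if e = i then 1 else 0) * (variable e :: ('n, 'k) mpoly))
      = (\<Sum>e\<in>UNIV. if e = i then variable e else 0)"
      by (intro sum.cong) auto
    hence eq: "variable i = (\<Sum>e\<in>UNIV. (if e = i then 1 else 0) * (variable e :: ('n, 'k) mpoly))"
      by simp
    show "variable i \<in> ?K" by (subst eq) (rule K_I)
  qed
  ultimately have "max_ideal \<subseteq> ?K" unfolding max_ideal_def by (rule ideal_of_minimal)
  thus ?thesis using assms by blast
qed

text \<open>Depth sensitivity of the Koszul complex: homology over \<open>S/I\<close> vanishes in
  degrees above \<open>n - length fs\<close>. The ideals \<open>N k\<close> are the successive sums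
  \<open>(f_1,...,f_k) + I\<close>, and the descending induction ends at
  \<open>N 0 = I\<close>.\<close>

lemma koszul_vanishing_regular_sequence:
  fixes idx :: "'n::finite \<Rightarrow> nat" and I :: "('n, 'k::field) mpoly set"
  assumes idx: "inj idx" and I: "is_ideal I"
    and fs: "set fs \<subseteq> max_ideal" "regular_sequence mpoly_ring (quotient_module mpoly_ring I) fs"
    and w: "\<And>\<sigma>. card \<sigma> + length fs \<le> CARD('n) \<Longrightarrow> w \<sigma> = 0" "\<And>\<sigma>. koszul_d idx variable w \<sigma> \<in> I"
  shows "\<exists>y. \<forall>\<sigma>. w \<sigma> - koszul_d idx variable y \<sigma> \<in> I"
proof -
  define N where "N k = ideal_sum (ideal_of (set (take k fs))) I" for k
  have take: "set (take (Suc k) fs) = insert (fs ! k) (set (take k fs))" if "k < length fs" for k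
    using that by (simp add: take_Suc_conv_app_nth)
  have N0: "N 0 = I" by (simp add: N_def ideal_of_empty ideal_sum_zero)
  have "\<exists>y. \<forall>\<sigma>. w \<sigma> - koszul_d idx variable y \<sigma> \<in> N 0"
  proof (rule koszul_vanishing[OF idx, where r = "length fs" and fs = "(!) fs"])
    fix k
    show "is_ideal (N k)" unfolding N_def by (intro is_ideal_ideal_sum ideal_of_is_ideal I)
    assume k: "k < length fs"
    show "\<exists>g. fs ! k = (\<Sum>e\<in>UNIV. g e * variable e)"
      using k fs(1) by (intro max_ideal_sum) auto
    show "N k \<subseteq> N (Suc k)"
      unfolding N_def take[OF k] by (intro ideal_sum_mono ideal_of_mono) auto
    show "fs ! k \<in> N (Suc k)"
      unfolding N_def take[OF k]
      using subset_ideal_sum(1)[OF ideal_of_is_ideal I] subset_ideal_of by blast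
    show "\<exists>b c. b \<in> N k \<and> a = b + c * fs ! k" if aN: "a \<in> N (Suc k)" for a
    proof -
      obtain g h where gh: "a = g + h" "g \<in> ideal_of (insert (fs ! k) (set (take k fs)))" "h \<in> I"
        using aN unfolding N_def take[OF k] ideal_sum_def by blast
      obtain b c where bc: "b \<in> ideal_of (set (take k fs))" "g = b + c * fs ! k"
        using ideal_of_insert[OF gh(2)] by blast
      have "b + h \<in> N k" unfolding N_def ideal_sum_def using bc(1) gh(3) by blast
      moreover have "a = (b + h) + c * fs ! k" using gh(1) bc(2) by simp
      ultimately show ?thesis by blast
    qed
    show "a \<in> N k" if "fs ! k * a \<in> N k" for a
      using fs(2) that k unfolding regular_sequence_quotient_module[OF I] N_def by blast
  qed (use w N0 in auto)
  thus ?thesis by (simp add: N0)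
qed


section \<open>The depth for a principal ideal\<close>

definition push :: "(('n \<Rightarrow>\<^sub>0 nat) \<Rightarrow> ('n \<Rightarrow>\<^sub>0 nat)) \<Rightarrow> ('n, 'k::field) mpoly \<Rightarrow> ('n, 'k) mpoly"
  where "push m f = (\<Sum>t\<in>keys f. Poly_Mapping.single (m t) (lookup f t))"

lemma push_eq_sum:
  assumes "finite A" "keys f \<subseteq> A"
  shows "push m f = (\<Sum>t\<in>A. Poly_Mapping.single (m t) (lookup f t))"
proof -
  have "\<forall>t\<in>A - keys f. Poly_Mapping.single (m t) (lookup f t) = 0"
    by (simp add: in_keys_iff)
  thus ?thesis unfolding push_def by (rule sum.mono_neutral_left[OF assms])
qed

lemma push_0 [simp]: "push m 0 = 0"
  by (simp add: push_def)

lemma push_single [simp]: "push m (Poly_Mapping.single t c) = Poly_Mapping.single (m t) c"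
  using push_eq_sum[of "{t}" "Poly_Mapping.single t c" m] by simp

lemma push_monomial [simp]: "push m (monomial t) = monomial (m t)"
  by (simp add: monomial_def)

lemma push_add: "push m (f + g) = push m f + push m g"
proof -
  let ?A = "keys f \<union> keys g"
  have "keys (f + g) \<subseteq> ?A" by (rule Poly_Mapping.keys_add)
  thus ?thesis
    by (simp add: push_eq_sum[of ?A] lookup_add single_add sum.distrib)
qed

lemma push_diff: "push m (f - g) = push m f - push m g"
  using push_add[of m "f - g" g] by simp

lemma push_sum: "push m (\<Sum>i\<in>A. f i) = (\<Sum>i\<in>A. push m (f i))"
  by (induction A rule: infinite_finite_induct) (auto simp: push_add)

lemma push_mult:
  assumes m: "\<And>s t. m (s + t) = m s + m t"
  shows "push m (f * g) = push m f * push m g"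
proof -
  have single: "push m (Poly_Mapping.single s c * g) = Poly_Mapping.single (m s) c * push m g"
    for s c
  proof -
    have "push m (Poly_Mapping.single s c * g)
      = push m (\<Sum>t\<in>keys g. Poly_Mapping.single s c * Poly_Mapping.single t (lookup g t))"
      using arg_cong[OF mpoly_eq_sum[of g], of "\<lambda>z. push m (Poly_Mapping.single s c * z)"]
      by (simp add: sum_distrib_left)
    also have "\<dots> = Poly_Mapping.single (m s) c * push m g"
      by (simp add: push_sum mult_single m push_def[of m g] sum_distrib_left)
    finally show ?thesis .
  qed
  have "push m (f * g)
    = push m (\<Sum>s\<in>keys f. Poly_Mapping.single s (lookup f s) * g)"
    using arg_cong[OF mpoly_eq_sum[of f], of "\<lambda>z. push m (z * g)"]
    by (simp add: sum_distrib_right)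
  also have "\<dots> = push m f * push m g"
    by (simp add: push_sum single push_def[of m f] sum_distrib_right)
  finally show ?thesis .
qed

text \<open>
  If \<open>p\<close> has terms outside the ideal, choose one of maximal degree in \<open>x\<^sub>j\<close> and one of maximal degree in
  \<open>x\<^sub>i\<close>: multiplying them by \<open>x\<^sub>j\<close> resp. \<open>x\<^sub>i\<close> gives terms of the product that cannot cancel.
\<close>

lemma supp_ideal_cancel_linear_form:
  fixes p :: "('n, 'k::field) mpoly"
  assumes ij: "i \<noteq> j" and U: "U \<subseteq> {v}"
    and mem: "p * (variable j - variable i) \<in> supp_ideal (up_closure U)"
  shows "p \<in> supp_ideal (up_closure U)"
proof (rule ccontr)
  assume "p \<notin> supp_ideal (up_closure U)"
  define D where "D = keys p - up_closure U"
  have D: "finite D" "D \<noteq> {}" using \<open>p \<notin> _\<close> by (auto simp: D_def supp_ideal_def)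
  have up: "t + unit_exp k \<in> up_closure U"
    if t: "t \<in> D" "\<And>s. s \<in> D \<Longrightarrow> lookup s k \<le> lookup t k"
      and kl: "k \<noteq> l" and mem: "p * (variable k - variable l) \<in> supp_ideal (up_closure U)" for t k l
  proof (rule ccontr)
    assume notin: "t + unit_exp k \<notin> up_closure U"
    let ?s = "t + unit_exp k - unit_exp l"
    \<comment> \<open>The only term of \<open>p\<close> that could cancel at \<open>t x_k\<close> is
      \<open>t x_k / x_l\<close>. It has a larger \<open>x_k\<close>-degree than \<open>t\<close>,
      and it is outside the ideal because its multiple \<open>t x_k\<close> is.\<close>
    have "unit_exp l \<preceq> t + unit_exp k \<Longrightarrow> lookup p ?s = 0"
    proof (rule ccontr)
      assume l: "unit_exp l \<preceq> t + unit_exp k" and "lookup p ?s \<noteq> 0"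
      have "?s \<preceq> t + unit_exp k" using exp_le_diff[OF l] by (metis exp_le_add(2))
      hence "?s \<notin> up_closure U"
        using notin up_closed_up_closure[of U] unfolding up_closed_def by blast
      hence "?s \<in> D" using \<open>lookup p ?s \<noteq> 0\<close> by (simp add: D_def in_keys_iff)
      from t(2)[OF this] show False using kl by (simp add: lookup_add lookup_minus lookup_unit_exp)
    qed
    hence "lookup (p * (variable k - variable l)) (t + unit_exp k) = lookup p t"
      by (simp add: right_diff_distrib lookup_minus mult.commute[of p] variable_eq lookup_monomial_times)
    also have "\<dots> \<noteq> 0" using t(1) by (simp add: D_def in_keys_iff)
    finally have "t + unit_exp k \<in> keys (p * (variable k - variable l))" by (simp add: in_keys_iff)
    thus False using mem notin by (auto simp: supp_ideal_def)
  qed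
  have max: "\<exists>t\<in>D. \<forall>s\<in>D. lookup s k \<le> lookup t k" for k
    using Max_in[of "(\<lambda>s. lookup s k) ` D"] Max_ge[of "(\<lambda>s. lookup s k) ` D"] D
    by fastforce
  obtain t where t: "t \<in> D" "\<And>s. s \<in> D \<Longrightarrow> lookup s j \<le> lookup t j"
    using max by blast
  obtain t' where t': "t' \<in> D" "\<And>s. s \<in> D \<Longrightarrow> lookup s i \<le> lookup t' i"
    using max by blast
  have mem': "p * (variable i - variable j) \<in> supp_ideal (up_closure U)"
    using is_ideal_uminus[OF is_ideal_supp_ideal[OF up_closed_up_closure] mem]
    by (simp add: algebra_simps)
  have 1: "t + unit_exp j \<in> up_closure U" using up[of t j i] t ij mem by blast
  have 2: "t' + unit_exp i \<in> up_closure U" using up[of t' i j] t' ij mem' by blast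
  from 1 have v: "v \<preceq> t + unit_exp j" "v \<in> U" using U by (auto simp: up_closure_def)
  from 2 have v': "v \<preceq> t' + unit_exp i" using U by (auto simp: up_closure_def)
  \<comment> \<open>\<open>v\<close> divides \<open>t x_j\<close> but not \<open>t\<close>, so
    \<open>t\<close> is too low precisely at \<open>j\<close>. As \<open>v\<close> divides
    \<open>t' x_i\<close> with \<open>i\<close> different from \<open>j\<close>, the monomial
    \<open>t'\<close> is high enough at \<open>j\<close>, against the maximality of
    \<open>t\<close>.\<close>
  have "\<not> v \<preceq> t" using t(1) v(2) by (auto simp: D_def up_closure_def)
  then obtain q where q: "lookup t q < lookup v q"
    by (auto simp: exp_le_def not_le)
  have "q = j"
    using q v(1)[unfolded exp_le_def, rule_format, of q]
      by (simp add: lookup_add lookup_unit_exp split: if_splits)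
  hence "lookup t j < lookup v j" using q by simp
  also have "\<dots> \<le> lookup t' j"
    using v'[unfolded exp_le_def, rule_format, of j] ij by (simp add: lookup_add lookup_unit_exp)
  also have "\<dots> \<le> lookup t j" using t(2) t'(1) by blast
  finally show False by simp
qed

text \<open>The effect on exponents of substituting \<open>x\<^sub>i\<close> for all variables in \<open>T\<close>.\<close>

definition merge :: "'n \<Rightarrow> 'n set \<Rightarrow> ('n::finite \<Rightarrow>\<^sub>0 nat) \<Rightarrow> ('n \<Rightarrow>\<^sub>0 nat)"
  where "merge i T t = (\<Sum>j\<in>UNIV. Poly_Mapping.single (if j \<in> T then i else j) (lookup t j))"

lemma merge_add: "merge i T (s + t) = merge i T s + merge i T t"
  by (simp add: merge_def lookup_add single_add sum.distrib)

lemma merge_0 [simp]: "merge i T 0 = 0"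
  by (simp add: merge_def)

lemma merge_unit_exp: "merge i T (unit_exp j) = unit_exp (if j \<in> T then i else j)"
proof -
  have "merge i T (unit_exp j)
    = (\<Sum>k\<in>UNIV. if k = j then unit_exp (if j \<in> T then i else j) else 0)"
    unfolding merge_def
    by (intro sum.cong refl; simp add: lookup_unit_exp; simp add: unit_exp_def)
  thus ?thesis by simp
qed

lemma exp_cases:
  obtains "t = 0" | s j where "t = s + unit_exp j"
proof (cases "t = 0")
  case False
  then obtain j where "lookup t j \<noteq> 0" by (metis lookup_zero poly_mapping_eqI)
  hence "unit_exp j \<preceq> t" by (simp add: exp_le_def lookup_unit_exp)
  thus ?thesis using that(2)[of "t - unit_exp j" j] exp_le_diff[of "unit_exp j" t]
    by (simp add: add.commute)
qed (use that in blast)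

lemma total_deg_merge [simp]: "total_deg (merge i T t) = total_deg t"
proof (induction "total_deg t" arbitrary: t)
  case (Suc n)
  have "t \<noteq> 0" using Suc.hyps(2) total_deg_eq_0_iff[of t] by auto
  then obtain s j where "t = s + unit_exp j" using exp_cases[of t] by blast
  thus ?case using Suc by (simp add: merge_add merge_unit_exp)
next
  case 0
  hence "t = 0" by (simp add: total_deg_eq_0_iff)
  thus ?case by simp
qed

definition linear_form :: "'n \<Rightarrow> 'n \<Rightarrow> ('n, 'k::field) mpoly"
  where "linear_form i j = variable j - variable i"

lemma monomial_diff_merge:
  "monomial t - monomial (merge i T t)
    \<in> (ideal_of (linear_form i ` T) :: ('n::finite, 'k::field) mpoly set)"
    (is "_ \<in> ?L")
proof (induction "total_deg t" arbitrary: t)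
  case 0
  hence "t = 0" by (simp add: total_deg_eq_0_iff)
  thus ?case using is_ideal_0[OF ideal_of_is_ideal] by simp
next
  case (Suc n)
  have "t \<noteq> 0" using Suc.hyps(2) total_deg_eq_0_iff[of t] by auto
  then obtain s j where t: "t = s + unit_exp j" using exp_cases[of t] by blast
  let ?j = "if j \<in> T then i else j"
  have "variable j - variable ?j \<in> ?L"
    using subset_ideal_of[of "linear_form i ` T :: ('n, 'k) mpoly set"] is_ideal_0[OF ideal_of_is_ideal]
    by (auto simp: linear_form_def)
  moreover have "monomial s - monomial (merge i T s) \<in> ?L" using Suc t by simp
  ultimately have "variable j * (monomial s - monomial (merge i T s))
      + monomial (merge i T s) * (variable j - variable ?j) \<in> ?L"
    by (intro is_ideal_add is_ideal_mult ideal_of_is_ideal)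
  also have "variable j * (monomial s - monomial (merge i T s))
      + monomial (merge i T s) * (variable j - variable ?j) = monomial t - monomial (merge i T t)"
    unfolding t merge_add merge_unit_exp monomial_add variable_eq[symmetric]
      by (simp add: algebra_simps)
  finally show ?case .
qed

lemma diff_push_merge:
  fixes f :: "('n::finite, 'k::field) mpoly"
  shows "f - push (merge i T) f \<in> ideal_of (linear_form i ` T)"
proof -
  have "f - push (merge i T) f
    = (\<Sum>t\<in>keys f. Poly_Mapping.single 0 (lookup f t) * (monomial t - monomial (merge i T t)))"
    using mpoly_eq_sum[of f]
    by (simp add: push_def right_diff_distrib sum_subtractf single_eq_times_monomial[symmetric])
  also have "\<dots> \<in> ideal_of (linear_form i ` T)"
    by (intro is_ideal_sum is_ideal_mult ideal_of_is_ideal monomial_diff_merge)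
  finally show ?thesis .
qed

text \<open>\<open>push (merge i T)\<close> is a retraction whose kernel is the ideal of the linear
  forms, so adding this ideal amounts to taking the preimage of the monomial ideal on the merged
  generators. A principal monomial ideal stays principal in this way.\<close>

lemma ideal_sum_linear_forms:
  fixes U :: "('n::finite \<Rightarrow>\<^sub>0 nat) set"
  shows "ideal_sum (ideal_of (linear_form i ` T)) (supp_ideal (up_closure U))
    = {f :: ('n, 'k::field) mpoly. push (merge i T) f \<in> supp_ideal (up_closure (merge i T ` U))}"
    (is "?N = ?P")
proof
  let ?V = "supp_ideal (up_closure (merge i T ` U)) :: ('n, 'k) mpoly set"
  have V: "is_ideal ?V" by (intro is_ideal_supp_ideal) simp
  have P: "is_ideal ?P"
    by (rule is_idealI)
      (auto simp: push_add push_mult[OF merge_add] intro: is_ideal_0[OF V] is_ideal_add[OF V] is_ideal_mult[OF V])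
  show "?N \<subseteq> ?P"
  proof (rule ideal_sum_minimal[OF P])
    have "push (merge i T) (linear_form i j) = (0 :: ('n, 'k) mpoly)" if "j \<in> T" for j
      using that by (simp add: linear_form_def push_diff variable_eq merge_unit_exp)
    thus "ideal_of (linear_form i ` T) \<subseteq> ?P"
      using is_ideal_0[OF V] by (intro ideal_of_minimal[OF P]) auto
    show "supp_ideal (up_closure U) \<subseteq> ?P"
    proof -
      have "ideal_of (monomial ` U) \<subseteq> ?P"
        using subset_up_closure[of "merge i T ` U"] by (intro ideal_of_minimal[OF P]) auto
      thus ?thesis by (simp add: ideal_of_monomials)
    qed
  qed
  have N: "is_ideal ?N" by (intro is_ideal_ideal_sum ideal_of_is_ideal is_ideal_supp_ideal) simp
  have sub: "ideal_of (linear_form i ` T) \<subseteq> ?N" "supp_ideal (up_closure U) \<subseteq> ?N"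
    by (intro subset_ideal_sum ideal_of_is_ideal is_ideal_supp_ideal; simp)+
  show "?P \<subseteq> ?N"
  proof
    fix f assume f: "f \<in> ?P"
    have "push (merge i T) f \<in> ?N"
    proof (rule is_ideal_memI[OF N])
      fix t assume "t \<in> keys (push (merge i T) f)"
      then obtain u where u: "u \<in> U" "merge i T u \<preceq> t"
        using f by (auto simp: supp_ideal_def up_closure_def)
      have "monomial u \<in> ?N" using subsetD[OF sub(2), of "monomial u"] u(1) subset_up_closure[of U]
        by auto
      from is_ideal_diff[OF N this subsetD[OF sub(1) monomial_diff_merge[of u]]]
      have "monomial (merge i T u) \<in> ?N" by simp
      from is_ideal_mult[OF N this, of "monomial (t - merge i T u)"]
      show "monomial t \<in> ?N"
        using exp_le_diff[OF u(2)] by (metis monomial_add mult.commute)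
    qed
    from is_ideal_add[OF N this subsetD[OF sub(1) diff_push_merge[of f]]] show "f \<in> ?N" by simp
  qed
qed

text \<open>The case \<open>U = {}\<close> is the zero ideal, and \<open>u \<noteq> 0\<close>
  excludes the unit ideal. Each linear form of the sequence substitutes \<open>x_i\<close> for one
  further variable, and at every stage the ideal to cancel against is again generated by at most one
  monomial.\<close>

lemma regular_sequence_principal:
  fixes U :: "('n::finite \<Rightarrow>\<^sub>0 nat) set"
  assumes U: "U \<subseteq> {u}" "u \<noteq> 0"
  shows "\<exists>fs. set fs \<subseteq> max_ideal \<and> length fs + 1 = CARD('n) \<and>
    regular_sequence mpoly_ring (quotient_module mpoly_ring (supp_ideal (up_closure U) :: ('n, 'k::field) mpoly set)) fs"
proof -
  obtain i :: 'n where True by simp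
  obtain js where js: "distinct js" "set js = UNIV - {i}"
    using finite_distinct_list[of "UNIV - {i}"] by auto
  let ?I = "supp_ideal (up_closure U) :: ('n, 'k) mpoly set"
  have I: "is_ideal ?I" by (intro is_ideal_supp_ideal) simp
  define fs :: "('n, 'k) mpoly list" where "fs = map (linear_form i) js"
  have len: "length fs + 1 = CARD('n)"
  proof -
    have "length fs = card (UNIV - {i})" using distinct_card[OF js(1)] js(2) by (simp add: fs_def)
    thus ?thesis by (simp add: card_Diff_singleton)
  qed
  have "set fs \<subseteq> max_ideal"
    unfolding max_ideal_def fs_def using subset_ideal_of[of "range variable"]
    by (auto simp: linear_form_def intro!: is_ideal_diff[OF ideal_of_is_ideal])
  moreover have "regular_sequence mpoly_ring (quotient_module mpoly_ring ?I) fs"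
    unfolding regular_sequence_quotient_module[OF I]
  proof (intro conjI allI impI)
    fix k x assume k: "k < length fs"
      and mem: "fs ! k * x \<in> ideal_sum (ideal_of (set (take k fs))) ?I"
    define T where "T = set (take k js)"
    have take: "set (take k fs) = linear_form i ` T" by (simp add: fs_def T_def take_map)
    have k': "k < length js" using k by (simp add: fs_def)
    have "js ! k \<notin> T"
      using js(1) k' by (auto simp: T_def in_set_conv_nth nth_eq_iff_index_eq)
    moreover have "i \<notin> T" using js(2) set_take_subset[of k js] by (auto simp: T_def)
    ultimately have "push (merge i T) (fs ! k) = fs ! k"
      using k' by (simp add: fs_def linear_form_def push_diff variable_eq merge_unit_exp)
    hence "push (merge i T) x * (variable (js ! k) - variable i)
      \<in> supp_ideal (up_closure (merge i T ` U))"
      using mem k' unfolding take ideal_sum_linear_forms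
      by (simp add: push_mult[OF merge_add] fs_def linear_form_def mult.commute)
    moreover have "js ! k \<noteq> i" using js(2) k' nth_mem by blast
    moreover have "merge i T ` U \<subseteq> {merge i T u}" using U by auto
    ultimately have "push (merge i T) x \<in> supp_ideal (up_closure (merge i T ` U))"
      using supp_ideal_cancel_linear_form by metis
    thus "x \<in> ideal_sum (ideal_of (set (take k fs))) ?I"
      unfolding take ideal_sum_linear_forms by simp
  next
    let ?T = "set js"
    have "push (merge i ?T) 1 = (1 :: ('n, 'k) mpoly)"
      using push_monomial[of "merge i ?T" 0] by simp
    \<comment> \<open>Merging preserves the total degree, so the merged generator is still not 1 and
      the last quotient is nonzero.\<close>
    moreover have "0 \<notin> up_closure (merge i ?T ` U)"
    proof
      assume "0 \<in> up_closure (merge i ?T ` U)"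
      hence "merge i ?T u \<preceq> 0" using U by (auto simp: up_closure_def)
      hence "total_deg (merge i ?T u) \<le> total_deg (0 :: 'n \<Rightarrow>\<^sub>0 nat)" by (rule total_deg_mono)
      thus False using U(2) total_deg_eq_0_iff[of u] total_deg_eq_0_iff[of "0 :: 'n \<Rightarrow>\<^sub>0 nat"]
        by simp
    qed
    ultimately have "1 \<notin> ideal_sum (ideal_of (set fs)) ?I"
      unfolding fs_def set_map ideal_sum_linear_forms by (simp add: supp_ideal_def)
    thus "ideal_sum (ideal_of (set fs)) ?I \<noteq> UNIV" by blast
  qed
  ultimately show ?thesis using len by blast
qed


section \<open>Stanley decompositions\<close>

abbreviation quot_module :: "('n, 'k::field) mpoly set \<Rightarrow> (('n, 'k) mpoly, ('n, 'k) mpoly set) module"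
  where "quot_module I \<equiv> quotient_module mpoly_ring I"

abbreviation coset :: "('n, 'k::field) mpoly set \<Rightarrow> ('n, 'k) mpoly \<Rightarrow> ('n, 'k) mpoly set"
  where "coset I f \<equiv> I +>\<^bsub>mpoly_ring\<^esub> f"

lemma quotient_grading_single:
  assumes "m \<in> quotient_grading I a"
  shows "\<exists>t c. m = coset I (Poly_Mapping.single t c)"
proof -
  obtain h where h: "m = coset I h" "\<forall>t\<in>keys h. \<forall>i. int (lookup t i) = a i"
    using assms by (auto simp: quotient_grading_def)
  have eq: "s = t" if "s \<in> keys h" "t \<in> keys h" for s t
    using h(2) that by (intro poly_mapping_eqI) (metis of_nat_eq_iff)
  have "\<exists>t c. h = Poly_Mapping.single t c"
  proof (cases "keys h = {}")
    case True
    hence "h = Poly_Mapping.single 0 0" by (intro poly_mapping_eqI) (auto simp: in_keys_iff)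
    thus ?thesis by blast
  next
    case False
    then obtain t where "t \<in> keys h" by blast
    hence "h = Poly_Mapping.single t (lookup h t)"
      using eq by (intro poly_mapping_eqI) (auto simp: lookup_single when_def in_keys_iff)
    thus ?thesis by blast
  qed
  thus ?thesis using h(1) by blast
qed

text \<open>The piece is one in which the monomial of \<open>g\<close>, the greatest common divisor
  of \<open>I\<close>, occurs. If \<open>Z\<close> missed at most one variable \<open>x_e\<close>,
  some \<open>w\<close> in \<open>E\<close> with \<open>w_e = g_e\<close> could be reached from
  \<open>g\<close> inside \<open>K[Z]\<close>; then a monomial of \<open>K[Z]\<close> would send the
  generator of the piece to 0, against freeness.\<close>

lemma stanley_decomposition_small_piece:
  fixes E :: "('n::finite \<Rightarrow>\<^sub>0 nat) set"
  assumes E: "up_closed E" "E \<noteq> {}" and nonprincipal: "\<And>u. E \<noteq> up_closure {u}"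
    and D: "stanley_decomposition (quot_module (supp_ideal E :: ('n, 'k::field) mpoly set))
      (quotient_grading (supp_ideal E)) D"
  obtains m Z where "(m, Z) \<in> set D" "card Z + 2 \<le> CARD('n)"
proof -
  let ?I = "supp_ideal E :: ('n, 'k) mpoly set"
  let ?M = "quot_module ?I"
  have I: "is_ideal ?I" by (rule is_ideal_supp_ideal[OF E(1)])
  define g :: "'n \<Rightarrow>\<^sub>0 nat" where
    "g = (\<Sum>i\<in>UNIV. Poly_Mapping.single i (LEAST k. \<exists>w\<in>E. lookup w i = k))"
  have g: "lookup g i = (LEAST k. \<exists>w\<in>E. lookup w i = k)" for i
    by (simp add: g_def lookup_sum lookup_single when_def)
  have g_attained: "\<exists>w\<in>E. lookup w i = lookup g i" for i
    unfolding g by (rule LeastI_ex) (use E(2) in blast)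
  have g_le: "g \<preceq> w" if "w \<in> E" for w
    unfolding exp_le_def g by (intro allI Least_le) (use that in blast)
  have "g \<notin> E"
  proof
    assume "g \<in> E"
    hence "E = up_closure {g}" using g_le E(1) unfolding up_closure_def up_closed_def by blast
    thus False using nonprincipal by blast
  qed
  note D' = D[unfolded stanley_decomposition_def]
  note D1 = conjunct1[OF D'] and D2 = conjunct1[OF conjunct2[OF D']]
    and D3 = conjunct2[OF conjunct2[OF D']]
  have hom: "\<exists>p. i < length D \<longrightarrow> fst (D ! i) = coset ?I (Poly_Mapping.single (fst p) (snd p))" for i
  proof (cases "i < length D")
    case True
    hence "D ! i \<in> set D" by simp
    from bspec[OF D1 this] obtain a where "fst (D ! i) \<in> quotient_grading ?I a"
      by (auto simp: case_prod_unfold)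
    from quotient_grading_single[OF this] obtain t c
      where "fst (D ! i) = coset ?I (Poly_Mapping.single t c)"
      by (elim exE) (rule that)
    thus ?thesis by (intro exI[of _ "(t, c)"]) simp
  qed blast
  from choice[OF allI[OF hom]] obtain p where
    p: "\<forall>i. i < length D \<longrightarrow> fst (D ! i) = coset ?I (Poly_Mapping.single (fst (p i)) (snd (p i)))"
    by (rule exE)
  define t c where "t i = fst (p i)" and "c i = snd (p i)" for i
  have tc: "fst (D ! i) = coset ?I (Poly_Mapping.single (t i) (c i))" if "i < length D" for i
    using p that by (simp add: t_def c_def)
  have "coset ?I (monomial g) \<in> carrier ?M" by (simp add: carrier_quotient_module[OF I])
  then obtain y where y: "y \<in> (\<Pi>\<^sub>E i\<in>{..<length D}. stanley_space ?M (fst (D ! i)) (snd (D ! i)))"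
    "coset ?I (monomial g) = (\<Oplus>\<^bsub>?M\<^esub>i\<in>{..<length D}. y i)"
    using ex1_implies_ex[OF bspec[OF D3]] by blast
  have lift: "\<exists>f. i < length D \<longrightarrow> f \<in> poly_subring (snd (D ! i)) \<and>
    y i = coset ?I (f * Poly_Mapping.single (t i) (c i))"
    for i
  proof (cases "i < length D")
    case True
    have "y i \<in> stanley_space ?M (fst (D ! i)) (snd (D ! i))" using y(1) True
      by (auto simp: PiE_iff)
    thus ?thesis by (auto simp: stanley_space_def tc[OF True] smult_quotient_module[OF I])
  qed blast
  from choice[OF allI[OF lift]] obtain f where f': "\<forall>i. i < length D \<longrightarrow>
      f i \<in> poly_subring (snd (D ! i)) \<and> y i = coset ?I (f i * Poly_Mapping.single (t i) (c i))"
    by (rule exE)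
  hence f: "\<And>i. i < length D \<Longrightarrow> f i \<in> poly_subring (snd (D ! i))"
    "\<And>i. i < length D \<Longrightarrow> y i = coset ?I (f i * Poly_Mapping.single (t i) (c i))"
    by simp_all
  let ?S = "\<Sum>i<length D. f i * Poly_Mapping.single (t i) (c i)"
  have "coset ?I (monomial g) = coset ?I ?S"
    unfolding y(2) by (rule finsum_quotient_module[OF I]) (auto simp: f(2))
  hence "monomial g - ?S \<in> ?I" by (simp add: coset_eq_iff[OF I])
  hence "lookup (monomial g - ?S) g = 0"
    using \<open>g \<notin> E\<close> by (auto simp: supp_ideal_def in_keys_iff)
  hence "lookup ?S g \<noteq> 0" by (simp add: lookup_minus lookup_monomial)
  then obtain i where i: "i < length D" "lookup (f i * Poly_Mapping.single (t i) (c i)) g \<noteq> 0"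
    unfolding lookup_sum by (metis (no_types, lifting) lessThan_iff sum.neutral)
  hence ti: "t i \<preceq> g" "g - t i \<in> keys (f i)" "c i \<noteq> 0"
    by (auto simp: mult.commute[of "f i"] lookup_single_times in_keys_iff split: if_splits)
  obtain m Z where mZ: "D ! i = (m, Z)" by fastforce
  have mZ_set: "(m, Z) \<in> set D" using i(1) mZ by (metis nth_mem)
  have free: "s + t i \<notin> E" if s: "keys s \<subseteq> Z" for s
  proof
    assume "s + t i \<in> E"
    hence "Poly_Mapping.single (s + t i) (c i) \<in> ?I" using ti(3) by (simp add: supp_ideal_def)
    hence "monomial s \<odot>\<^bsub>?M\<^esub> m = \<zero>\<^bsub>?M\<^esub>"
      using tc[OF i(1)] mZ
      by (simp add: smult_quotient_module[OF I] zero_quotient_module[OF I] coset_eq_iff[OF I]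
          monomial_def mult_single)
    moreover have "monomial s \<in> (poly_subring Z :: ('n, 'k) mpoly set)" using s
      by (simp add: poly_subring_def)
    ultimately have "monomial s = (0 :: ('n, 'k) mpoly)"
      using bspec[OF D2 mZ_set] by simp
    thus False using keys_monomial[of s] by (metis insert_not_empty keys_zero)
  qed
  have "card Z + 2 \<le> CARD('n)"
  proof (rule ccontr)
    assume "\<not> card Z + 2 \<le> CARD('n)"
    hence "card (- Z) \<le> Suc 0" by (simp add: Compl_eq_Diff_UNIV card_Diff_subset)
    hence "\<forall>x\<in>-Z. \<forall>y\<in>-Z. x = y" by (simp add: card_le_Suc0_iff_eq)
    hence "\<exists>e. - Z \<subseteq> {e}" by blast
    then obtain e where e: "- Z \<subseteq> {e}" by blast
    obtain w where w: "w \<in> E" "lookup w e = lookup g e"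
      using g_attained by blast
    let ?s = "(g - t i) + (w - g)"
    have "keys (g - t i) \<subseteq> Z"
      using f(1)[OF i(1)] ti(2) mZ by (auto simp: poly_subring_def)
    moreover have "keys (w - g) \<subseteq> Z"
      using e w(2) by (auto simp: in_keys_iff lookup_minus)
    ultimately have "keys ?s \<subseteq> Z" using Poly_Mapping.keys_add[of "g - t i" "w - g"] by blast
    moreover have "?s + t i = w"
      using exp_le_diff[OF ti(1)] exp_le_diff[OF g_le[OF w(1)]] by (metis add.assoc add.commute)
    ultimately show False using free w(1) by metis
  qed
  with mZ_set show thesis by (rule that)
qed

section \<open>Stanley decompositions from partitions into cones\<close>

definition restrict_supp :: "('n \<Rightarrow>\<^sub>0 nat) set \<Rightarrow> ('n, 'k::field) mpoly \<Rightarrow> ('n, 'k) mpoly"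
  where "restrict_supp V f = (\<Sum>t\<in>keys f \<inter> V. Poly_Mapping.single t (lookup f t))"

lemma lookup_restrict_supp:
  "lookup (restrict_supp V f) t = (if t \<in> V then lookup f t else 0)"
  by (auto simp: restrict_supp_def lookup_sum lookup_single when_def in_keys_iff sum.delta)

lemma stanley_space_monomial:
  fixes I :: "('n, 'k::field) mpoly set"
  assumes I: "is_ideal I"
  shows "stanley_space (quot_module I) (coset I (monomial m)) Z = coset I ` supp_ideal (cone m Z)"
proof -
  have "(\<lambda>f. f * monomial m) ` poly_subring Z = (supp_ideal (cone m Z) :: ('n, 'k) mpoly set)"
  proof (intro equalityI subsetI)
    fix h :: "('n, 'k) mpoly" assume "h \<in> (\<lambda>f. f * monomial m) ` poly_subring Z"
    then obtain f where f: "h = monomial m * f" "f \<in> poly_subring Z" by (auto simp: mult.commute)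
    have "t \<in> cone m Z" if "t \<in> keys h" for t
    proof -
      have m: "m \<preceq> t" "t - m \<in> keys f"
        using that by (auto simp: f(1) in_keys_iff lookup_monomial_times split: if_splits)
      hence "keys (t - m) \<subseteq> Z" using f(2) by (auto simp: poly_subring_def)
      hence "lookup (t - m) i = 0" if "i \<notin> Z" for i using that by (auto simp: in_keys_iff)
      thus ?thesis using m(1) by (auto simp: cone_def exp_le_def lookup_minus intro: order_antisym)
    qed
    thus "h \<in> supp_ideal (cone m Z)" by (auto simp: supp_ideal_def)
  next
    fix h :: "('n, 'k) mpoly" assume h: "h \<in> supp_ideal (cone m Z)"
    define f where "f = (\<Sum>t\<in>keys h. Poly_Mapping.single (t - m) (lookup h t))"
    have mt: "m \<preceq> t" "keys (t - m) \<subseteq> Z" if "t \<in> keys h" for t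
    proof -
      have t: "t \<in> cone m Z" using h that by (auto simp: supp_ideal_def)
      thus "m \<preceq> t" by (simp add: cone_def)
      show "keys (t - m) \<subseteq> Z"
      proof
        fix i assume "i \<in> keys (t - m)"
        hence "lookup t i \<noteq> lookup m i" by (auto simp: in_keys_iff lookup_minus)
        thus "i \<in> Z" using t unfolding cone_def by blast
      qed
    qed
    have "f * monomial m = (\<Sum>t\<in>keys h. Poly_Mapping.single t (lookup h t))"
      unfolding f_def sum_distrib_right monomial_def mult_single
      by (intro sum.cong) (auto simp: add.commute exp_le_diff[OF mt(1)])
    hence "h = f * monomial m" using mpoly_eq_sum[of h] by simp
    moreover have "f \<in> poly_subring Z"
    proof -
      have "keys f \<subseteq> (\<Union>t\<in>keys h. keys (Poly_Mapping.single (t - m) (lookup h t)))"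
        unfolding f_def by (rule keys_sum)
      also have "\<dots> \<subseteq> (\<lambda>t. t - m) ` keys h" by auto
      finally show ?thesis using mt(2) by (auto simp: poly_subring_def)
    qed
    ultimately show "h \<in> (\<lambda>f. f * monomial m) ` poly_subring Z" by blast
  qed
  thus ?thesis unfolding stanley_space_def smult_quotient_module[OF I] by (metis image_image)
qed

text \<open>Each component of a coset is the part of a representative supported on the corresponding
  cone. The coset determines it because the cones are disjoint from each other and from
  \<open>E\<close>, so that \<open>I\<close> contributes nothing to the coefficients in
  them.\<close>

lemma stanley_decomposition_of_cones:
  fixes E :: "('n::finite \<Rightarrow>\<^sub>0 nat) set" and D :: "(('n \<Rightarrow>\<^sub>0 nat) \<times> 'n set) list"
  assumes E: "up_closed E"
    and D: "\<And>t. length (filter (\<lambda>(m, Z). t \<in> cone m Z) D) = (if t \<in> - E then 1 else 0)"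
  shows "stanley_decomposition (quot_module (supp_ideal E :: ('n, 'k::field) mpoly set))
    (quotient_grading (supp_ideal E)) (map (\<lambda>(m, Z). (coset (supp_ideal E) (monomial m), Z)) D)"
proof -
  let ?I = "supp_ideal E :: ('n, 'k) mpoly set"
  let ?M = "quot_module ?I"
  let ?D = "map (\<lambda>(m, Z). (coset ?I (monomial m), Z)) D"
  have I: "is_ideal ?I" by (rule is_ideal_supp_ideal[OF E])
  define C where "C i = cone (fst (D ! i)) (snd (D ! i))" for i
  have card_C: "card {i. i < length D \<and> t \<in> C i} = (if t \<in> - E then 1 else 0)" for t
    using D[of t] by (simp add: length_filter_conv_card C_def case_prod_beta)
  have C_E: "t \<notin> E" if "i < length D" "t \<in> C i" for i t
  proof
    assume "t \<in> E"
    hence "{i. i < length D \<and> t \<in> C i} = {}" using card_C[of t] by simp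
    thus False using that by blast
  qed
  have C_part: "\<exists>j. \<forall>i. (i < length D \<and> t \<in> C i) = (i = j)" if "t \<notin> E" for t
  proof -
    have "card {i. i < length D \<and> t \<in> C i} = 1" using card_C[of t] that by simp
    then obtain j where "{i. i < length D \<and> t \<in> C i} = {j}" by (rule card_1_singletonE)
    hence "i < length D \<and> t \<in> C i \<longleftrightarrow> i = j" for i by (simp add: set_eq_iff)
    thus ?thesis by (intro exI allI)
  qed
  have space: "stanley_space ?M (fst (?D ! i)) (snd (?D ! i)) = coset ?I ` supp_ideal (C i)"
    if "i < length D" for i
  proof -
    have "?D ! i = (coset ?I (monomial (fst (D ! i))), snd (D ! i))"
      using that by (cases "D ! i") simp
    thus ?thesis by (simp only: fst_conv snd_conv stanley_space_monomial[OF I] C_def)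
  qed
  have ex1: "\<exists>!y. y \<in> (\<Pi>\<^sub>E i\<in>{..<length D}. coset ?I ` supp_ideal (C i)) \<and>
      coset ?I f = (\<Oplus>\<^bsub>?M\<^esub>i\<in>{..<length D}. y i)" for f
  proof (rule ex_ex1I)
    define y where "y = (\<lambda>i\<in>{..<length D}. coset ?I (restrict_supp (C i) f))"
    have "coset ?I f = (\<Oplus>\<^bsub>?M\<^esub>i\<in>{..<length D}. y i)"
    proof -
      have "(\<Oplus>\<^bsub>?M\<^esub>i\<in>{..<length D}. y i) = coset ?I (\<Sum>i<length D. restrict_supp (C i) f)"
        by (rule finsum_quotient_module[OF I]) (auto simp: y_def)
      moreover have "f - (\<Sum>i<length D. restrict_supp (C i) f) \<in> ?I"
      proof -
        have "lookup (f - (\<Sum>i<length D. restrict_supp (C i) f)) t = 0" if tE: "t \<notin> E" for t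
        proof -
          from C_part[OF tE] obtain j where j: "\<forall>i. (i < length D \<and> t \<in> C i) = (i = j)"
            by (rule exE)
          have j': "j < length D" using j[rule_format, of j] by simp
          have in_C: "t \<in> C i \<longleftrightarrow> i = j" if "i < length D" for i
            using j[rule_format, of i] that by simp
          have "(\<Sum>i<length D. if t \<in> C i then lookup f t else 0)
            = (\<Sum>i<length D. if i = j then lookup f t else 0)"
            by (intro sum.cong) (simp_all add: in_C)
          thus ?thesis using j' by (simp add: lookup_minus lookup_sum lookup_restrict_supp)
        qed
        thus ?thesis unfolding supp_ideal_def by (auto simp: in_keys_iff)
      qed
      ultimately show ?thesis by (simp add: coset_eq_iff[OF I])
    qed
    moreover have "restrict_supp (C i) f \<in> supp_ideal (C i)" for i
      by (auto simp: supp_ideal_def in_keys_iff lookup_restrict_supp split: if_splits)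
    hence "y \<in> (\<Pi>\<^sub>E i\<in>{..<length D}. coset ?I ` supp_ideal (C i))"
      by (auto simp: y_def)
    ultimately show "\<exists>y. y \<in> (\<Pi>\<^sub>E i\<in>{..<length D}. coset ?I ` supp_ideal (C i)) \<and>
      coset ?I f = (\<Oplus>\<^bsub>?M\<^esub>i\<in>{..<length D}. y i)" by blast
  next
    fix y y'
    assume "y \<in> (\<Pi>\<^sub>E i\<in>{..<length D}. coset ?I ` supp_ideal (C i)) \<and>
        coset ?I f = (\<Oplus>\<^bsub>?M\<^esub>i\<in>{..<length D}. y i)"
      and "y' \<in> (\<Pi>\<^sub>E i\<in>{..<length D}. coset ?I ` supp_ideal (C i)) \<and>
        coset ?I f = (\<Oplus>\<^bsub>?M\<^esub>i\<in>{..<length D}. y' i)"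
    hence y: "y \<in> (\<Pi>\<^sub>E i\<in>{..<length D}. coset ?I ` supp_ideal (C i))"
        "coset ?I f = (\<Oplus>\<^bsub>?M\<^esub>i\<in>{..<length D}. y i)"
      and y': "y' \<in> (\<Pi>\<^sub>E i\<in>{..<length D}. coset ?I ` supp_ideal (C i))"
        "coset ?I f = (\<Oplus>\<^bsub>?M\<^esub>i\<in>{..<length D}. y' i)" by auto
    have lift: "\<exists>h. \<forall>i<length D. h i \<in> supp_ideal (C i) \<and> z i = coset ?I (h i)"
      if "z \<in> (\<Pi>\<^sub>E i\<in>{..<length D}. coset ?I ` supp_ideal (C i))" for z
    proof -
      have "\<forall>i\<in>{..<length D}. \<exists>h. h \<in> supp_ideal (C i) \<and> z i = coset ?I h"
        using that by (auto simp: PiE_iff)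
      from bchoice[OF this] show ?thesis by auto
    qed
    obtain h where h: "\<And>i. i < length D \<Longrightarrow> h i \<in> supp_ideal (C i)"
      "\<And>i. i < length D \<Longrightarrow> y i = coset ?I (h i)" using lift[OF y(1)] by blast
    obtain h' where h': "\<And>i. i < length D \<Longrightarrow> h' i \<in> supp_ideal (C i)"
      "\<And>i. i < length D \<Longrightarrow> y' i = coset ?I (h' i)" using lift[OF y'(1)] by blast
    have "coset ?I f = coset ?I (\<Sum>i<length D. h i)"
      unfolding y(2) by (rule finsum_quotient_module[OF I]) (auto simp: h(2))
    moreover have "coset ?I f = coset ?I (\<Sum>i<length D. h' i)"
      unfolding y'(2) by (rule finsum_quotient_module[OF I]) (auto simp: h'(2))
    ultimately have diff: "(\<Sum>i<length D. h i) - (\<Sum>i<length D. h' i) \<in> ?I"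
      by (simp add: coset_eq_iff[OF I, symmetric])
    have "h i = h' i" if i: "i < length D" for i
    proof (rule poly_mapping_eqI)
      fix t
      have zero: "lookup (h j) t = 0" "lookup (h' j) t = 0"
        if "j < length D" "t \<notin> C j" for j
        using h(1)[OF that(1)] h'(1)[OF that(1)] that(2) by (auto simp: supp_ideal_def in_keys_iff)
      show "lookup (h i) t = lookup (h' i) t"
      proof (cases "t \<in> C i")
        case True
        have tE: "t \<notin> E" using C_E[OF i True] .
        from C_part[OF tE] obtain l where l: "\<forall>i. (i < length D \<and> t \<in> C i) = (i = l)" by (rule exE)
        have other: "t \<notin> C j" if "j < length D" "j \<noteq> i" for j
          using l[rule_format, of i] l[rule_format, of j] i True that by simp
        have "(\<Sum>j<length D. lookup (h j) t) = (\<Sum>j<length D. if j = i then lookup (h i) t else 0)"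
          using zero(1) other by (intro sum.cong) auto
        moreover have "(\<Sum>j<length D. lookup (h' j) t) = (\<Sum>j<length D. if j
          = i then lookup (h' i) t else 0)"
          using zero(2) other by (intro sum.cong) auto
        moreover have "lookup ((\<Sum>i<length D. h i) - (\<Sum>i<length D. h' i)) t = 0"
          using diff tE by (auto simp: supp_ideal_def in_keys_iff)
        ultimately show ?thesis using i by (simp add: lookup_minus lookup_sum)
      qed (simp add: zero i)
    qed
    hence "y i = y' i" if "i \<in> {..<length D}" for i using h(2) h'(2) that by simp
    thus "y = y'" by (rule PiE_ext[OF y(1) y'(1)])
  qed
  show ?thesis
    unfolding stanley_decomposition_def
  proof (intro conjI ballI)
    fix p assume "p \<in> set ?D"
    then obtain m Z where p: "p = (coset ?I (monomial m), Z)" by auto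
    have "coset ?I (monomial m) \<in> quotient_grading ?I (\<lambda>i. int (lookup m i))"
      by (auto simp: quotient_grading_def)
    thus "case p of (m, Z) \<Rightarrow> m \<in> carrier ?M \<and> (\<exists>a. m \<in> quotient_grading ?I a)"
      by (auto simp: p carrier_quotient_module[OF I])
  next
    fix p assume "p \<in> set ?D"
    then obtain m Z where p: "p = (coset ?I (monomial m), Z)" "(m, Z) \<in> set D" by auto
    then obtain i where i: "i < length D" "D ! i = (m, Z)" by (auto simp: in_set_conv_nth)
    have "f = 0" if f: "f \<in> poly_subring Z" "f \<odot>\<^bsub>?M\<^esub> coset ?I (monomial m) = \<zero>\<^bsub>?M\<^esub>" for f
    proof -
      have "monomial m * f \<in> ?I"
        using f(2) by (simp add: smult_quotient_module[OF I] zero_quotient_module[OF I] coset_eq_iff[OF I] mult.commute)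
      have "s \<notin> keys f" for s
      proof
        assume s: "s \<in> keys f"
        hence "m + s \<in> keys (monomial m * f)" by (simp add: in_keys_iff lookup_monomial_times)
        hence "m + s \<in> E" using \<open>monomial m * f \<in> ?I\<close> by (auto simp: supp_ideal_def)
        moreover have "keys s \<subseteq> Z" using s f(1) by (auto simp: poly_subring_def)
        hence "lookup s k = 0" if "k \<notin> Z" for k
          using that by (auto simp: in_keys_iff)
        \<comment> \<open>Multiplication by monomials of \<open>K[Z]\<close> stays in the cone,
          which avoids \<open>E\<close>; so no term of \<open>f\<close> can be absorbed by
          \<open>I\<close>.\<close>
        hence "m + s \<in> C i" using i by (simp add: C_def cone_def lookup_add)
        ultimately show False using C_E[OF i(1)] by blast
      qed
      thus "f = 0" by (intro poly_mapping_eqI) (simp add: in_keys_iff)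
    qed
    thus "case p of (m, Z) \<Rightarrow> \<forall>f\<in>poly_subring Z. f \<odot>\<^bsub>?M\<^esub> m = \<zero>\<^bsub>?M\<^esub> \<longrightarrow> f = 0"
      by (simp add: p)
  next
    fix x assume "x \<in> carrier ?M"
    then obtain f where x: "x = coset ?I f" by (auto simp: carrier_quotient_module[OF I])
    have eq: "(\<Pi>\<^sub>E i\<in>{..<length ?D}. stanley_space ?M (fst (?D ! i)) (snd (?D ! i)))
      = (\<Pi>\<^sub>E i\<in>{..<length D}. coset ?I ` supp_ideal (C i))"
      unfolding length_map by (intro PiE_cong) (simp only: lessThan_iff space)
    show "\<exists>!y. y \<in> (\<Pi>\<^sub>E i\<in>{..<length ?D}. stanley_space ?M (fst (?D ! i)) (snd (?D ! i))) \<and>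
        x = (\<Oplus>\<^bsub>?M\<^esub>i\<in>{..<length ?D}. y i)"
      unfolding x eq unfolding length_map by (rule ex1)
  qed
qed

section \<open>The two bounds for the Stanley depth and the conclusion\<close>

lemma sdepth_ge_of_cones:
  fixes E :: "('n::finite \<Rightarrow>\<^sub>0 nat) set"
  assumes "up_closed E" "cone_partitionable k (- E)"
  shows "enat k \<le> sdepth (quot_module (supp_ideal E :: ('n, 'k::field) mpoly set)) (quotient_grading (supp_ideal E))"
proof -
  obtain D where D: "\<And>m Z. (m, Z) \<in> set D \<Longrightarrow> k \<le> card Z"
    "\<And>t. length (filter (\<lambda>(m, Z). t \<in> cone m Z) D) = (if t \<in> - E then 1 else 0)"
    using cone_partitionable_list[OF assms(2)] by blast
  let ?D = "map (\<lambda>(m, Z). (coset (supp_ideal E :: ('n, 'k) mpoly set) (monomial m), Z)) D"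
  have "enat k \<le> sdepth_decomposition ?D"
    unfolding sdepth_decomposition_def by (rule INF_greatest) (use D(1) in auto)
  also have "\<dots> \<le> sdepth (quot_module (supp_ideal E :: ('n, 'k) mpoly set)) (quotient_grading (supp_ideal E))"
    unfolding sdepth_def
    by (rule SUP_upper) (use stanley_decomposition_of_cones[OF assms(1) D(2)] in simp)
  finally show ?thesis .
qed

lemma sdepth_le_nonprincipal:
  fixes E :: "('n::finite \<Rightarrow>\<^sub>0 nat) set"
  assumes "up_closed E" "E \<noteq> {}" "\<And>u. E \<noteq> up_closure {u}"
  shows "sdepth (quot_module (supp_ideal E :: ('n, 'k::field) mpoly set)) (quotient_grading (supp_ideal E))
    \<le> enat (CARD('n) - 2)"
  unfolding sdepth_def
proof (rule SUP_least)
  fix D assume "D \<in> {D. stanley_decomposition (quot_module (supp_ideal E :: ('n, 'k) mpoly set)) (quotient_grading (supp_ideal E)) D}"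
  then obtain m Z where mZ: "(m, Z) \<in> set D" "card Z + 2 \<le> CARD('n)"
    using stanley_decomposition_small_piece[OF assms] by blast
  have "sdepth_decomposition D \<le> (case (m, Z) of (m, Z) \<Rightarrow> enat (card Z))"
    unfolding sdepth_decomposition_def by (rule INF_lower[OF mZ(1)])
  also have "\<dots> \<le> enat (CARD('n) - 2)" using mZ(2) by simp
  finally show "sdepth_decomposition D \<le> enat (CARD('n) - 2)" .
qed

theorem theorem2p4:
  fixes I :: "('n::finite, 'k::field) mpoly set"
  assumes "monomial_ideal I"
    and "has_linear_quotients I"
    and "depth mpoly_ring max_ideal (quotient_module mpoly_ring I) + 2 = enat CARD('n)"
  shows "sdepth (quotient_module mpoly_ring I) (quotient_grading I) + 2 = enat CARD('n)"
proof -
  obtain E where E: "up_closed E" and I_eq: "I = supp_ideal E"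
    using monomial_ideal_eq_supp_ideal[OF assms(1)] .
  have I: "is_ideal I" unfolding I_eq by (rule is_ideal_supp_ideal[OF E])
  have max: "is_ideal (max_ideal :: ('n, 'k) mpoly set)"
    unfolding max_ideal_def by (rule ideal_of_is_ideal)
  \<comment> \<open>The equation rules out infinite depth, so \<open>I\<close> is proper, and it
    gives \<open>n \<ge> 2\<close>, so that \<open>n - 2\<close> is not truncated.\<close>
  obtain d where d: "depth mpoly_ring max_ideal (quot_module I) = enat d" "d + 2 = CARD('n)"
    using assms(3) by (cases "depth mpoly_ring max_ideal (quot_module I)") (auto simp: numeral_eq_enat)
  note depth = depth_quotient_module[OF I max d(1)]
  have "0 \<notin> E"
  proof
    assume "0 \<in> E"
    hence "1 \<in> I" using monomial_mem_supp_ideal[of 0 E] by (simp add: I_eq)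
    hence "I = UNIV" by (rule is_ideal_eq_UNIV[OF I])
    thus False using depth(1) subset_ideal_sum(2)[OF max I] by blast
  qed
  have nonprincipal: "E \<noteq> up_closure U" if U: "U \<subseteq> {u}" for U u
  proof
    assume EU: "E = up_closure U"
    obtain i :: 'n where True by simp
    \<comment> \<open>If \<open>u = 0\<close>, properness of \<open>I\<close> forces
      \<open>U = {}\<close>, and any nonzero exponent can stand in for \<open>u\<close>.\<close>
    have "\<exists>u'. U \<subseteq> {u'} \<and> u' \<noteq> 0"
    proof (cases "u = 0")
      case True
      hence "U = {}" using U \<open>0 \<notin> E\<close> subset_up_closure[of U] unfolding EU by blast
      moreover have "unit_exp i \<noteq> 0"
        using total_deg_unit_exp[of i] total_deg_eq_0_iff[of "unit_exp i"] by auto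
      ultimately show ?thesis by blast
    qed (use U in blast)
    then obtain u' where u': "U \<subseteq> {u'}" "u' \<noteq> 0" by blast
    obtain fs :: "('n, 'k) mpoly list" where "set fs \<subseteq> max_ideal" "length fs + 1 = CARD('n)"
      "regular_sequence mpoly_ring (quot_module I) fs"
      using regular_sequence_principal[OF u'] unfolding I_eq EU by blast
    thus False using depth(3)[of fs] d(2) by simp
  qed
  define G where "G = min_exps E"
  have EG: "up_closure G = E" unfolding G_def by (rule up_closure_min_exps[OF E])
  obtain r0 where "lq_rank G r0"
    using linear_quotients_lq_rank[of E] assms(2) unfolding I_eq G_def by blast
  then obtain r where r: "lq_rank G r"
    "\<And>u v. u \<in> G \<Longrightarrow> v \<in> G \<Longrightarrow> r u < r v \<Longrightarrow> total_deg u \<le> total_deg v"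
    using lq_rank_sort by blast
  obtain fs where fs: "set fs \<subseteq> max_ideal" "length fs = d"
    "regular_sequence mpoly_ring (quot_module I) fs"
    using depth(2) by blast
  obtain idx :: "'n \<Rightarrow> nat" where idx: "inj idx"
    using finite_imp_inj_to_nat_seg[OF finite_class.finite_UNIV] by blast
  have "a = c" if "v \<in> G" "a \<in> colon_vars G r v" "c \<in> colon_vars G r v" for v a c
  proof (rule colon_vars_unique[OF idx r _ that, where 'k = 'k])
    fix w :: "'n set \<Rightarrow> ('n, 'k) mpoly"
    assume w: "\<And>\<sigma>. card \<sigma> \<le> 2 \<Longrightarrow> w \<sigma> = 0"
      "\<And>\<sigma>. koszul_d idx variable w \<sigma> \<in> supp_ideal (up_closure G)"
    \<comment> \<open>With \<open>d = n - 2\<close> the support bound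
      \<open>card \<sigma> + d \<le> n\<close> reads \<open>card \<sigma> \<le> 2\<close>.\<close>
    show "\<exists>y. \<forall>\<sigma>. w \<sigma> - koszul_d idx variable y \<sigma> \<in> supp_ideal (up_closure G)"
      using koszul_vanishing_regular_sequence[OF idx I fs(1,3), of w] w fs(2) d(2)
      unfolding EG I_eq by simp
  qed
  hence "cone_partitionable d {t. \<not> (\<exists>g\<in>G. g \<preceq> t)}"
    using d(2) by (intro cone_partitionable_lq[OF r(1)]) auto
  also have "{t. \<not> (\<exists>g\<in>G. g \<preceq> t)} = - E" unfolding EG[symmetric] by (auto simp: up_closure_def)
  finally have "enat d \<le> sdepth (quot_module I) (quotient_grading I)"
    unfolding I_eq by (rule sdepth_ge_of_cones[OF E])
  moreover have "sdepth (quot_module I) (quotient_grading I) \<le> enat (CARD('n) - 2)"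
    unfolding I_eq
  proof (rule sdepth_le_nonprincipal[OF E])
    show "E \<noteq> {}" using nonprincipal[of "{}" 0] by (auto simp: up_closure_def)
    show "E \<noteq> up_closure {u}" for u by (rule nonprincipal) simp
  qed
  moreover have "CARD('n) - 2 = d" using d(2) by simp
  ultimately have "sdepth (quot_module I) (quotient_grading I) = enat d"
    by (simp add: order_antisym)
  thus ?thesis using d(2) by (simp add: numeral_eq_enat)
qed

end
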